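(* Let $\mathcal{A}$ and $\mathcal{B}$ be unital $C^*$-algebras and $\phi:\mathcal{A}\to\mathcal{B}$ a positive unital linear map. Suppose there exists a conditional expectation $\mathcal{E}:\mathcal{B}\to\mathcal{C}$ from $\mathcal{B}$ onto a $C^*$-subalgebra $\mathcal{C}$. Let $f:U\to\mathbb{R}$ be a convex function defined on some open convex set $U\subseteq\mathbb{R}^n$; let $a_1,\dots,a_n\in\mathcal{A}$ be mutually commuting self-adjoint elements such that $\prod_{i=1}^n\sigma(a_i)\subseteq U$ and such that $\phi(a_1),\dots,\phi(a_n)$ belong to the centralizer $\mathcal{B}^{\mathcal{E}}$ and are mutually commuting; and let $g:I\to\mathbb{R}$ be a convex increasing function defined on some open interval $I$ with $\mathrm{Im}(f)\subseteq I$. Then $$\mathcal{E}\big(g[f(\phi(a_1),\dots,\phi(a_n))]\big)\leq\mathcal{E}\big(g[\phi(f(a_1,\dots,a_n))]\big).$$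
   Context: A linear map between $C^*$-algebras is positive if it maps positive elements to positive elements. $\sigma(a)$ denotes the spectrum of $a$. Let $\mathcal{C}\subseteq\mathcal{B}$ be $C^*$-algebras. A conditional expectation $\mathcal{E}:\mathcal{B}\to\mathcal{C}$ is a positive $\mathcal{C}$-linear projection from $\mathcal{B}$ onto $\mathcal{C}$ of norm $1$. The centralizer of $\mathcal{E}$ is $\mathcal{B}^{\mathcal{E}}=\{b\in\mathcal{B}:\ \mathcal{E}(bx)=\mathcal{E}(xb)\ \text{for all } x\in\mathcal{B}\}$. Multivariable functional calculus: for mutually commuting self-adjoint elements $a_1,\dots,a_n$ of a unital $C^*$-algebra, the unital $C^*$-algebra $C^*(a_1,\dots,a_n)$ they generate is abelian; its joint spectrum is $\sigma(a_1,\dots,a_n)=\{(\gamma(a_1),\dots,\gamma(a_n)):\gamma \text{ a character of } C^*(a_1,\dots,a_n)\}\subseteq\prod_i\sigma(a_i)$, and $C^*(a_1,\dots,a_n)\cong C(\sigma(a_1,\dots,a_n))$ with $a_i$ corresponding to the $i$-th coordinate function. For $f$ continuous on the joint spectrum, $f(a_1,\dots,a_n)$ is the element corresponding to $f$ (restricted to the joint spectrum) under this $^*$-isomorphism. *)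

theory Defs
  imports "HOL-Analysis.Analysis"
begin

text \<open>Unital \<open>C\<^sup>*\<close>-algebras. The base class \<open>real_normed_algebra_1\<close> has the axiom
  \<open>norm 1 = 1\<close>, which in a \<open>C\<^sup>*\<close>-algebra only excludes the zero algebra.\<close>

class cstar_algebra = real_normed_algebra_1 + banach +
  fixes scaleC :: "complex \<Rightarrow> 'a \<Rightarrow> 'a"  (infixr \<open>*\<^sub>C\<close> 75)
    and star :: "'a \<Rightarrow> 'a"
  assumes scaleC_add_right: "c *\<^sub>C (x + y) = c *\<^sub>C x + c *\<^sub>C y"
    and scaleC_add_left: "(c + d) *\<^sub>C x = c *\<^sub>C x + d *\<^sub>C x"
    and scaleC_scaleC: "c *\<^sub>C d *\<^sub>C x = (c * d) *\<^sub>C x"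
    and scaleC_of_real: "complex_of_real r *\<^sub>C x = r *\<^sub>R x"
    and mult_scaleC_left: "(c *\<^sub>C x) * y = c *\<^sub>C (x * y)"
    and mult_scaleC_right: "x * (c *\<^sub>C y) = c *\<^sub>C (x * y)"
    and norm_scaleC: "norm (c *\<^sub>C x) = cmod c * norm x"
    and star_add: "star (x + y) = star x + star y"
    and star_scaleC: "star (c *\<^sub>C x) = cnj c *\<^sub>C star x"
    and star_mult: "star (x * y) = star y * star x"
    and star_star: "star (star x) = x"
    and cstar_identity: "norm (star x * x) = (norm x)\<^sup>2"

definition clinear_map :: "('a::cstar_algebra \<Rightarrow> 'b::cstar_algebra) \<Rightarrow> bool" where
  "clinear_map \<phi> \<longleftrightarrow>
     (\<forall>x y. \<phi> (x + y) = \<phi> x + \<phi> y) \<and> (\<forall>c x. \<phi> (c *\<^sub>C x) = c *\<^sub>C \<phi> x)"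

definition spectrum :: "'a::cstar_algebra \<Rightarrow> complex set" where
  "spectrum a = {z. \<not> (\<exists>b. (a - z *\<^sub>C 1) * b = 1 \<and> b * (a - z *\<^sub>C 1) = 1)}"

text \<open>\<open>C\<^sup>*\<close>-subalgebras are norm-closed; they need not contain the unit of the ambient algebra.\<close>

definition cstar_subalgebra :: "'a::cstar_algebra set \<Rightarrow> bool" where
  "cstar_subalgebra S \<longleftrightarrow>
     0 \<in> S \<and> (\<forall>x\<in>S. \<forall>y\<in>S. x + y \<in> S \<and> x * y \<in> S) \<and>
     (\<forall>c. \<forall>x\<in>S. c *\<^sub>C x \<in> S) \<and> (\<forall>x\<in>S. star x \<in> S) \<and> closed S"

text \<open>Positivity and order relative to a \<open>C\<^sup>*\<close>-subalgebra \<open>S\<close>, regarded as a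
  \<open>C\<^sup>*\<close>-algebra in its own right; the whole algebra is \<open>S = UNIV\<close>.\<close>

definition positive_in :: "'a::cstar_algebra set \<Rightarrow> 'a \<Rightarrow> bool" where
  "positive_in S x \<longleftrightarrow> (\<exists>y\<in>S. x = star y * y)"

definition le_in :: "'a::cstar_algebra set \<Rightarrow> 'a \<Rightarrow> 'a \<Rightarrow> bool" where
  "le_in S x y \<longleftrightarrow> x \<in> S \<and> y \<in> S \<and> positive_in S (y - x)"

definition positive_map_into ::
    "'b::cstar_algebra set \<Rightarrow> ('a::cstar_algebra \<Rightarrow> 'b) \<Rightarrow> bool" where
  "positive_map_into S \<phi> \<longleftrightarrow> (\<forall>x. positive_in UNIV x \<longrightarrow> positive_in S (\<phi> x))"

definition conditional_expectation ::
    "'b::cstar_algebra set \<Rightarrow> ('b \<Rightarrow> 'b) \<Rightarrow> bool" where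
  "conditional_expectation C E \<longleftrightarrow>
     clinear_map E \<and> positive_map_into C E \<and>
     (\<forall>x. E x \<in> C) \<and> (\<forall>c\<in>C. E c = c) \<and>
     (\<forall>c\<in>C. \<forall>x. E (c * x) = c * E x \<and> E (x * c) = E x * c) \<and>
     bounded_linear E \<and> onorm E = 1"

definition centralizer :: "('b::cstar_algebra \<Rightarrow> 'b) \<Rightarrow> 'b set" where
  "centralizer E = {b. \<forall>x. E (b * x) = E (x * b)}"

definition cstar_generated :: "('n \<Rightarrow> 'a::cstar_algebra) \<Rightarrow> 'a set" where
  "cstar_generated a = (\<lambda>S. cstar_subalgebra S \<and> 1 \<in> S) hull (range a)"

definition is_character :: "'a::cstar_algebra set \<Rightarrow> ('a \<Rightarrow> complex) \<Rightarrow> bool" where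
  "is_character S \<gamma> \<longleftrightarrow>
     (\<forall>x\<in>S. \<forall>y\<in>S. \<gamma> (x + y) = \<gamma> x + \<gamma> y \<and> \<gamma> (x * y) = \<gamma> x * \<gamma> y) \<and>
     (\<forall>c. \<forall>x\<in>S. \<gamma> (c *\<^sub>C x) = c * \<gamma> x) \<and> (\<exists>x\<in>S. \<gamma> x \<noteq> 0)"

text \<open>The joint spectrum is only used for self-adjoint tuples, on which characters take real
  values; it is therefore a subset of \<open>\<real>\<^sup>n\<close>.\<close>

definition joint_spectrum :: "('n::finite \<Rightarrow> 'a::cstar_algebra) \<Rightarrow> (real ^ 'n) set" where
  "joint_spectrum a =
     {x. \<exists>\<gamma>. is_character (cstar_generated a) \<gamma> \<and> (\<forall>i. \<gamma> (a i) = complex_of_real (x $ i))}"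

text \<open>\<open>\<Phi>\<close> is the unital \<open>*\<close>-isomorphism from \<open>C(K)\<close>, \<open>K\<close> the joint spectrum, onto the generated
  algebra that sends the coordinate functions to the \<open>a i\<close>. An element of \<open>C(K)\<close> is represented
  by any total function that is continuous on \<open>K\<close>, so two functions are the same element iff
  they agree on \<open>K\<close>; this is what the clause \<open>\<Phi> h = \<Phi> k \<longleftrightarrow> \<dots>\<close> (well-definedness and
  injectivity) takes care of.\<close>

definition is_calculus_iso ::
    "('n::finite \<Rightarrow> 'a::cstar_algebra) \<Rightarrow> ((real ^ 'n \<Rightarrow> complex) \<Rightarrow> 'a) \<Rightarrow> bool" where
  "is_calculus_iso a \<Phi> \<longleftrightarrow>
     (let K = joint_spectrum a; CK = {h. continuous_on K h} in
        (\<forall>h\<in>CK. \<forall>k\<in>CK. \<Phi> (\<lambda>x. h x + k x) = \<Phi> h + \<Phi> k \<and> \<Phi> (\<lambda>x. h x * k x) = \<Phi> h * \<Phi> k) \<and>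
        (\<forall>c. \<forall>h\<in>CK. \<Phi> (\<lambda>x. c * h x) = c *\<^sub>C \<Phi> h) \<and>
        (\<forall>h\<in>CK. \<Phi> (\<lambda>x. cnj (h x)) = star (\<Phi> h)) \<and>
        \<Phi> (\<lambda>x. 1) = 1 \<and>
        (\<forall>h\<in>CK. \<forall>k\<in>CK. \<Phi> h = \<Phi> k \<longleftrightarrow> (\<forall>x\<in>K. h x = k x)) \<and>
        \<Phi> ` CK = cstar_generated a \<and>
        (\<forall>i. \<Phi> (\<lambda>x. complex_of_real (x $ i)) = a i))"

text \<open>\<open>f(a\<^sub>1, \<dots>, a\<^sub>n)\<close>, meaningful for commuting self-adjoint \<open>a i\<close> and \<open>f\<close> continuous on the
  joint spectrum.\<close>

definition func_calc ::
    "(real ^ 'n \<Rightarrow> real) \<Rightarrow> ('n::finite \<Rightarrow> 'a::cstar_algebra) \<Rightarrow> 'a" where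
  "func_calc f a = (THE y. \<exists>\<Phi>. is_calculus_iso a \<Phi> \<and> y = \<Phi> (\<lambda>x. complex_of_real (f x)))"

definition func_calc1 :: "(real \<Rightarrow> real) \<Rightarrow> 'a::cstar_algebra \<Rightarrow> 'a" where
  "func_calc1 g b = func_calc (\<lambda>x :: real ^ 1. g (x $ 1)) (\<lambda>_. b)"

end

theory Submission
  imports Defs
begin

text \<open>
  The argument compares \<open>X = g(\<phi>(f(a)))\<close> with \<open>Y = g(f(\<phi>(a)))\<close> by means of affine functions of the
  commuting tuple \<open>b = \<phi>(a)\<close>. A convex function is the supremum of its affine minorants. At a point
  \<open>t\<close> of the joint spectrum of \<open>b\<close>, let \<open>l\<close> be an affine minorant of \<open>f\<close> with \<open>l(t) = f(t)\<close> and
  let \<open>\<beta> \<ge> 0\<close> be a slope of \<open>g\<close> at \<open>s = f(t)\<close>. Positivity of \<open>\<phi>\<close> gives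
  \<open>l(b) = \<phi>(l(a)) \<le> \<phi>(f(a))\<close>, and functional calculus for the single element \<open>\<phi>(f(a))\<close> gives
  \<open>X \<ge> g(s) + \<beta> (\<phi>(f(a)) - s)\<close>. Hence \<open>X \<ge> L(b)\<close> for the affine function \<open>L = g(s) + \<beta> (l - s)\<close>,
  which agrees with \<open>g \<circ> f\<close> at \<open>t\<close>.

  The element \<open>X\<close> need not commute with \<open>b\<close>, so these inequalities cannot be combined by taking a
  supremum. This is where the centralizer enters
  (\<open>expectation_ge_of_affine_minorants\<close>): given \<open>\<epsilon> > 0\<close>, compactness yields finitely many of the
  functions \<open>L\<close>, say \<open>L\<^sub>1, \<dots>, L\<^sub>r\<close>, and continuous \<open>k\<^sub>1, \<dots>, k\<^sub>r\<close> on the joint spectrum with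
  \<open>\<Sum> k\<^sub>j\<^sup>2 = 1\<close> and \<open>L\<^sub>j > g \<circ> f - \<epsilon>\<close> wherever \<open>k\<^sub>j \<noteq> 0\<close>. As the \<open>k\<^sub>j(b)\<close> lie in the centralizer of \<open>E\<close>,
  \<open>E(X) = \<Sum> E(k\<^sub>j(b) X k\<^sub>j(b)) \<ge> E(\<Sum> k\<^sub>j(b) L\<^sub>j(b) k\<^sub>j(b)) \<ge> E(Y) - \<epsilon> E(1)\<close>.

  The rest supplies the \<open>C\<^sup>*\<close>-theory. Positivity is taken to mean self-adjoint with
  \<open>\<parallel>r - x\<parallel> \<le> r\<close> for some real \<open>r\<close>. A convergent iteration provides square roots
  (\<open>sqrt_exists\<close>), the positive elements form a closed cone, and \<open>y\<^sup>* y\<close> is positive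
  (\<open>pos_star_mult\<close>). Characters are obtained from the order instead of from maximal ideals: in a
  commutative algebra of self-adjoint elements, a maximal proper module over the positive cone
  determines a real character, and an element is positive if all real characters are
  non-negative on it (\<open>pos_of_characters\<close>). No spectral radius formula and no Gelfand-Mazur
  theorem is used. The Gelfand transform is then isometric on self-adjoint elements, the Stone-Weierstrass theorem
  makes it onto, and its inverse is the functional calculus (\<open>is_calculus_iso_calc\<close>,
  \<open>calculus_iso_unique\<close>, \<open>func_calc\<close>).
\<close>

section \<open>Star operation and complex scalars\<close>

lemma star_one [simp]: "star (1::'a::cstar_algebra) = 1"
  by (metis mult.right_neutral star_mult star_star)

lemma star_zero [simp]: "star (0::'a::cstar_algebra) = 0"
  by (metis add_cancel_right_right star_add)

lemma star_minus [simp]: "star (- x) = - star (x::'a::cstar_algebra)"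
  by (metis add.right_inverse add_eq_0_iff star_add star_zero)

lemma star_diff: "star (x - y) = star x - star (y::'a::cstar_algebra)"
  by (metis add_uminus_conv_diff star_add star_minus)

lemma star_scaleR [simp]: "star (r *\<^sub>R x) = r *\<^sub>R star (x::'a::cstar_algebra)"
  by (metis complex_cnj_complex_of_real scaleC_of_real star_scaleC)

lemma norm_star [simp]: "norm (star x) = norm (x::'a::cstar_algebra)"
proof -
  have le: "norm y \<le> norm (star y)" for y :: 'a
  proof (cases "y = 0")
    case False
    have "norm y * norm y \<le> norm (star y) * norm y"
      by (metis cstar_identity norm_mult_ineq power2_eq_square)
    then show ?thesis using False by simp
  qed simp
  show ?thesis using le[of x] le[of "star x"] by (simp add: star_star)
qed

lemma bounded_linear_star: "bounded_linear (star :: 'a::cstar_algebra \<Rightarrow> 'a)"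
  by (rule bounded_linear_intro[where K=1]) (simp_all add: star_add)

lemmas continuous_on_star [continuous_intros] =
  bounded_linear.continuous_on[OF bounded_linear_star]

lemma scaleC_zero_right [simp]: "c *\<^sub>C (0::'a::cstar_algebra) = 0"
  by (metis add_cancel_right_right scaleC_add_right)

lemma scaleC_zero_left [simp]: "0 *\<^sub>C x = (0::'a::cstar_algebra)"
  by (metis of_real_0 scaleC_of_real scaleR_zero_left)

lemma scaleC_minus_one: "(-1) *\<^sub>C x = - (x::'a::cstar_algebra)"
  by (metis of_real_1 of_real_minus scaleC_of_real scaleR_minus1_left)

lemma scaleC_minus_left: "(- c) *\<^sub>C x = - (c *\<^sub>C (x::'a::cstar_algebra))"
  by (metis mult_minus1 scaleC_minus_one scaleC_scaleC)

lemma scaleC_minus_right: "c *\<^sub>C (- x) = - (c *\<^sub>C (x::'a::cstar_algebra))"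
  by (metis mult.commute scaleC_minus_one scaleC_scaleC)

lemma scaleC_diff_right: "c *\<^sub>C (x - y) = c *\<^sub>C x - c *\<^sub>C (y::'a::cstar_algebra)"
  by (metis add_uminus_conv_diff scaleC_add_right scaleC_minus_right)

lemma scaleC_ii_ii [simp]: "\<i> *\<^sub>C \<i> *\<^sub>C x = - (x::'a::cstar_algebra)"
  by (simp add: scaleC_scaleC scaleC_minus_one)

lemma scaleC_scaleR: "c *\<^sub>C (r *\<^sub>R x) = r *\<^sub>R (c *\<^sub>C (x::'a::cstar_algebra))"
  by (metis mult.commute scaleC_of_real scaleC_scaleC)

lemma scaleC_decompose: "c *\<^sub>C x = Re c *\<^sub>R x + Im c *\<^sub>R (\<i> *\<^sub>C (x::'a::cstar_algebra))"
proof -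
  have "c *\<^sub>C x = (complex_of_real (Re c) + complex_of_real (Im c) * \<i>) *\<^sub>C x"
    by (metis complex_eq mult.commute)
  then show ?thesis by (simp only: scaleC_add_left scaleC_of_real flip: scaleC_scaleC)
qed

text \<open>The self-adjoint real and imaginary part of an element.\<close>

definition re_part :: "'a::cstar_algebra \<Rightarrow> 'a" where
  "re_part x = (1/2) *\<^sub>R (x + star x)"

definition im_part :: "'a::cstar_algebra \<Rightarrow> 'a" where
  "im_part x = (1/2) *\<^sub>R (\<i> *\<^sub>C (star x - x))"

lemma re_im_decompose: "x = re_part x + \<i> *\<^sub>C im_part (x::'a::cstar_algebra)"
proof -
  have "\<i> *\<^sub>C im_part x = (1/2) *\<^sub>R (x - star x)"
    unfolding im_part_def by (simp add: scaleC_scaleR)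
  then have "re_part x + \<i> *\<^sub>C im_part x = (1/2) *\<^sub>R (x + x)"
    unfolding re_part_def by (simp add: algebra_simps)
  then show ?thesis by (metis scaleR_half_double scaleR_right_distrib)
qed

lemma star_re_part [simp]: "star (re_part x) = re_part (x::'a::cstar_algebra)"
  by (simp add: re_part_def star_add star_star add.commute)

lemma star_im_part [simp]: "star (im_part x) = im_part (x::'a::cstar_algebra)"
proof -
  have "star (\<i> *\<^sub>C (star x - x)) = - \<i> *\<^sub>C (x - star x)"
    by (simp add: star_scaleC star_diff star_star)
  also have "\<dots> = \<i> *\<^sub>C (star x - x)"
    by (metis minus_diff_eq mult_minus1_right scaleC_minus_one scaleC_scaleC)
  finally show ?thesis by (simp add: im_part_def)
qed

section \<open>Square roots and the cone of positive elements\<close>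

text \<open>The iteration \<open>y\<^sub>k\<^sub>+\<^sub>1 = (w + y\<^sub>k\<^sup>2)/2\<close> with \<open>w = 1 - x\<close> converges to a solution of
  \<open>(1 - y)\<^sup>2 = x\<close>. It is dominated by the same iteration \<open>s\<^sub>k\<close> for the real number \<open>w = 1\<close>, which
  increases to \<open>1\<close>. The last clause places the root in every closed
  real subspace that contains \<open>x\<close> and is closed under squares; such a subspace need not contain the unit.\<close>

lemma sqrt_exists:
  fixes x :: "'a::{real_normed_algebra_1,banach}"
  assumes "norm (1 - x) \<le> 1"
  obtains v where "v * v = x" "norm (1 - v) \<le> 1"
    "\<And>T. \<lbrakk>closed T; subspace T; \<And>z. z \<in> T \<Longrightarrow> z * z \<in> T; x \<in> T\<rbrakk> \<Longrightarrow> v \<in> T"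
proof -
  define w where "w = 1 - x"
  define y where "y = rec_nat (0::'a) (\<lambda>_ z. (1/2) *\<^sub>R (w + z * z))"
  define s where "s = rec_nat (0::real) (\<lambda>_ z. (1 + z * z) / 2)"
  have y0: "y 0 = 0" and yS: "y (Suc k) = (1/2) *\<^sub>R (w + y k * y k)" for k
    by (simp_all add: y_def)
  have s0: "s 0 = 0" and sS: "s (Suc k) = (1 + s k * s k) / 2" for k
    by (simp_all add: s_def)
  have s01: "0 \<le> s k \<and> s k \<le> 1" for k
  proof (induction k)
    case (Suc k)
    then have "s k * s k \<le> 1" by (simp add: mult_le_one)
    then show ?case using Suc by (simp add: sS)
  qed (simp add: s0)
  have sinc: "s (Suc k) - s k = (1 - s k) * (1 - s k) / 2" for k
    by (simp add: sS field_simps)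
  have "incseq s"
    by (rule incseq_SucI) (smt (verit) sinc zero_le_mult_iff divide_nonneg_nonneg)
  then obtain L where L: "s \<longlonglongrightarrow> L"
    using incseq_convergent[of s 1] s01 by blast
  have "(\<lambda>k. s (Suc k)) \<longlonglongrightarrow> (1 + L * L) / 2"
    unfolding sS by (intro tendsto_intros L) auto
  then have "L = (1 + L * L) / 2"
    using LIMSEQ_Suc[OF L] LIMSEQ_unique by blast
  then have "(L - 1) * (L - 1) = 0" by (simp add: field_simps)
  then have s1: "s \<longlonglongrightarrow> 1" using L by simp
  have wn: "norm w \<le> 1" using assms by (simp add: w_def)
  have comm: "y k * w = w * y k" for k
    by (induction k) (simp_all add: y0 yS distrib_left distrib_right, metis mult.assoc)
  have comm': "y (Suc k) * y k = y k * y (Suc k)" for k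
    by (simp add: yS distrib_left distrib_right comm mult.assoc)
  have yn: "norm (y k) \<le> s k" for k
  proof (induction k)
    case (Suc k)
    have "norm (y k * y k) \<le> s k * s k"
      by (rule order_trans[OF norm_mult_ineq]) (rule mult_mono[OF Suc Suc], use s01 in auto)
    then have "norm (w + y k * y k) \<le> 1 + s k * s k"
      using wn norm_triangle_ineq[of w "y k * y k"] by linarith
    then show ?case by (simp add: yS sS)
  qed (simp add: y0 s0)
  have yd: "norm (y (Suc k) - y k) \<le> s (Suc k) - s k" for k
  proof (induction k)
    case 0
    then show ?case using wn by (simp add: yS sS y0 s0)
  next
    case (Suc k)
    have "y (Suc (Suc k)) - y (Suc k) = (1/2) *\<^sub>R (y (Suc k) * y (Suc k) - y k * y k)"
      by (subst (1 2) yS) (simp add: algebra_simps)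
    also have "\<dots> = (1/2) *\<^sub>R ((y (Suc k) - y k) * (y (Suc k) + y k))"
      using comm'[of k] by (simp add: algebra_simps)
    finally have "norm (y (Suc (Suc k)) - y (Suc k)) = norm ((y (Suc k) - y k) * (y (Suc k) + y k)) / 2"
      by simp
    also have "\<dots> \<le> (s (Suc k) - s k) * (s (Suc k) + s k) / 2"
    proof -
      have "norm (y (Suc k) + y k) \<le> s (Suc k) + s k"
        using yn[of k] yn[of "Suc k"] norm_triangle_ineq[of "y (Suc k)" "y k"] by linarith
      then have "norm (y (Suc k) - y k) * norm (y (Suc k) + y k) \<le> (s (Suc k) - s k) * (s (Suc k) + s k)"
        by (intro mult_mono[OF Suc]) (use Suc norm_ge_zero order_trans in blast)+
      then show ?thesis
        using norm_mult_ineq[of "y (Suc k) - y k" "y (Suc k) + y k"] by linarith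
    qed
    also have "\<dots> = s (Suc (Suc k)) - s (Suc k)"
      by (simp add: sS[of "Suc k"]) (simp add: sS[of k] algebra_simps)
    finally show ?case .
  qed
  have "summable (\<lambda>k. y (Suc k) - y k)"
    by (rule summable_comparison_test[OF _ telescope_summable[OF s1]]) (use yd in blast)
  then have "convergent (\<lambda>n. \<Sum>k<n. y (Suc k) - y k)"
    by (simp add: summable_iff_convergent)
  then have "convergent y"
    by (simp add: sum_lessThan_telescope y0)
  then obtain Y where Y: "y \<longlonglongrightarrow> Y" by (auto simp: convergent_def)
  have "(\<lambda>k. y (Suc k)) \<longlonglongrightarrow> (1/2) *\<^sub>R (w + Y * Y)"
    unfolding yS by (intro tendsto_intros Y)
  then have Yeq: "Y = (1/2) *\<^sub>R (w + Y * Y)"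
    using LIMSEQ_Suc[OF Y] LIMSEQ_unique by blast
  then have Y2: "Y + Y = w + Y * Y"
    by (metis scaleR_half_double scaleR_right_distrib)
  show ?thesis
  proof
    show "(1 - Y) * (1 - Y) = x"
      using Y2 by (simp add: algebra_simps w_def)
    have "norm Y \<le> 1"
      by (rule LIMSEQ_le_const2[OF tendsto_norm[OF Y]]) (use yn s01 order_trans in blast)
    then show "norm (1 - (1 - Y)) \<le> 1" by simp
    fix T assume T: "closed T" "subspace T" "\<And>z. z \<in> T \<Longrightarrow> z * z \<in> T" "x \<in> T"
    \<comment> \<open>The unit is avoided: \<open>1 - Y\<close> is also the limit of \<open>s\<^sub>k - y\<^sub>k\<close>, since \<open>s\<^sub>k \<rightarrow> 1\<close>.\<close>
    have mem: "s k *\<^sub>R 1 - y k \<in> T" for k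
    proof (induction k)
      case 0 then show ?case using subspace_0[OF T(2)] by (simp add: y0 s0)
    next
      case (Suc k)
      define z where "z = s k *\<^sub>R 1 - y k"
      have yk: "y k = s k *\<^sub>R 1 - z" by (simp add: z_def)
      have "s (Suc k) *\<^sub>R 1 - y (Suc k) = (1/2) *\<^sub>R x - (1/2) *\<^sub>R (z * z) + s k *\<^sub>R z"
        unfolding sS yS yk
        by (simp add: w_def algebra_simps add_divide_distrib) (simp flip: scaleR_add_left)
      moreover have "z \<in> T" using Suc by (simp add: z_def)
      ultimately show ?case
        by (simp only:) (intro subspace_add subspace_diff subspace_scale T)
    qed
    have "(\<lambda>k. s k *\<^sub>R 1 - y k) \<longlonglongrightarrow> 1 *\<^sub>R 1 - Y"
      by (intro tendsto_diff tendsto_scaleR tendsto_const Y s1)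
    from closed_sequentially[OF T(1) mem this] show "1 - Y \<in> T" by simp
  qed
qed

text \<open>Positivity, defined through the norm. For self-adjoint \<open>x\<close> the inequality says that the
  spectrum of \<open>x\<close> lies in \<open>[0, 2r]\<close>. It holds for all larger \<open>r\<close> once it holds for
  one, so sums of positive elements are positive without any spectral theory.\<close>

definition pos :: "'a::cstar_algebra \<Rightarrow> bool" where
  "pos x \<longleftrightarrow> star x = x \<and> (\<exists>r. norm (r *\<^sub>R 1 - x) \<le> r)"

lemma pos_star: "pos x \<Longrightarrow> star x = x"
  by (simp add: pos_def)

lemma norm_sub_mono:
  fixes x :: "'a::real_normed_algebra_1"
  assumes "norm (r *\<^sub>R 1 - x) \<le> r" "r \<le> r'"
  shows "norm (r' *\<^sub>R 1 - x) \<le> r'"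
proof -
  have "r' *\<^sub>R 1 - x = (r' - r) *\<^sub>R 1 + (r *\<^sub>R 1 - x)"
    by (simp add: algebra_simps)
  then have "norm (r' *\<^sub>R 1 - x) \<le> norm ((r' - r) *\<^sub>R (1::'a)) + norm (r *\<^sub>R 1 - x)"
    by (metis norm_triangle_ineq)
  then show ?thesis using assms by simp
qed

lemma pos_add:
  assumes "pos x" "pos y" shows "pos (x + y)"
proof -
  obtain r s where r: "norm (r *\<^sub>R 1 - x) \<le> r" and s: "norm (s *\<^sub>R 1 - y) \<le> s"
    using assms by (auto simp: pos_def)
  have "(r + s) *\<^sub>R 1 - (x + y) = (r *\<^sub>R 1 - x) + (s *\<^sub>R 1 - y)"
    by (simp add: algebra_simps)
  then have "norm ((r + s) *\<^sub>R 1 - (x + y)) \<le> r + s"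
    using r s norm_triangle_mono by metis
  then show ?thesis using assms by (auto simp: pos_def star_add)
qed

lemma pos_scaleR:
  assumes "pos x" "c \<ge> 0" shows "pos (c *\<^sub>R x)"
proof -
  obtain r where r: "norm (r *\<^sub>R 1 - x) \<le> r" using assms by (auto simp: pos_def)
  have "(c * r) *\<^sub>R 1 - c *\<^sub>R x = c *\<^sub>R (r *\<^sub>R 1 - x)" by (simp add: algebra_simps)
  then have "norm ((c * r) *\<^sub>R 1 - c *\<^sub>R x) \<le> c * r"
    using r assms(2) by (simp add: mult_left_mono)
  then show ?thesis using assms(1) unfolding pos_def by (metis star_scaleR)
qed

lemma pos_const: "c \<ge> 0 \<Longrightarrow> pos (c *\<^sub>R 1)"
  unfolding pos_def by (auto intro!: exI[of _ c])

lemma pos_zero [simp]: "pos 0"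
  using pos_const[of 0] by simp

lemma pos_one [simp]: "pos 1"
  using pos_const[of 1] by simp

lemma pos_sum: "(\<And>i. i \<in> A \<Longrightarrow> pos (f i)) \<Longrightarrow> pos (sum f A)"
  by (induction A rule: infinite_finite_induct) (auto intro: pos_add)

lemma norm_selfadj_sq: "star x = x \<Longrightarrow> norm (x * x) = norm (x::'a::cstar_algebra) * norm x"
  by (metis cstar_identity power2_eq_square)

lemma pos_norm_diff:
  fixes x :: "'a::cstar_algebra"
  assumes "star x = x" "norm x \<le> r"
  shows "pos (r *\<^sub>R 1 - x)" "pos (r *\<^sub>R 1 + x)"
  using assms by (auto simp: pos_def star_diff star_add intro!: exI[of _ r])

lemma pos_sqrt:
  assumes "pos x"
  obtains v where "v * v = x" "pos v"
    "\<And>T. \<lbrakk>closed T; subspace T; \<And>z. z \<in> T \<Longrightarrow> z * z \<in> T; x \<in> T\<rbrakk> \<Longrightarrow> v \<in> T"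
proof -
  obtain r0 where r0: "norm (r0 *\<^sub>R 1 - x) \<le> r0" using assms by (auto simp: pos_def)
  define r where "r = max r0 1"
  have r: "r > 0" by (simp add: r_def)
  have rx: "norm (r *\<^sub>R 1 - x) \<le> r" using norm_sub_mono[OF r0] by (simp add: r_def)
  have "1 - (1/r) *\<^sub>R x = (1/r) *\<^sub>R (r *\<^sub>R 1 - x)" using r by (simp add: algebra_simps)
  then have "norm (1 - (1/r) *\<^sub>R x) \<le> 1" using rx r by simp
  then obtain v where v: "v * v = (1/r) *\<^sub>R x" "norm (1 - v) \<le> 1"
    "\<And>T. \<lbrakk>closed T; subspace T; \<And>z. z \<in> T \<Longrightarrow> z * z \<in> T; (1/r) *\<^sub>R x \<in> T\<rbrakk> \<Longrightarrow> v \<in> T"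
    using sqrt_exists by blast
  have "v \<in> {z. star z = z}"
  proof (rule v(3))
    show "closed {z::'a. star z = z}"
      by (intro closed_Collect_eq continuous_intros)
    show "subspace {z::'a. star z = z}"
      by (auto simp: subspace_def star_add)
  qed (use assms in \<open>auto simp: star_mult pos_star\<close>)
  then have "pos v" using v(2) unfolding pos_def by (auto intro!: exI[of _ 1])
  show ?thesis
  proof
    show "(sqrt r *\<^sub>R v) * (sqrt r *\<^sub>R v) = x" using v(1) r by simp
    show "pos (sqrt r *\<^sub>R v)" by (rule pos_scaleR[OF \<open>pos v\<close>]) (use r in simp)
    fix T assume T: "closed T" "subspace T" "\<And>z. z \<in> T \<Longrightarrow> z * z \<in> T" "x \<in> T"
    show "sqrt r *\<^sub>R v \<in> T"
      by (intro subspace_scale T v(3))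
  qed
qed

lemma pos_sqrt_commute:
  assumes "pos x"
  obtains v where "v * v = x" "pos v" "\<And>u. x * u = u * x \<Longrightarrow> v * u = u * v"
proof -
  obtain v where v: "v * v = x" "pos v"
    "\<And>T. \<lbrakk>closed T; subspace T; \<And>z. z \<in> T \<Longrightarrow> z * z \<in> T; x \<in> T\<rbrakk> \<Longrightarrow> v \<in> T"
    using pos_sqrt[OF assms] by blast
  have "v * u = u * v" if "x * u = u * x" for u
  proof -
    have "v \<in> {z. z * u = u * z}"
    proof (rule v(3))
      show "closed {z. z * u = u * z}"
        by (intro closed_Collect_eq continuous_intros)
      show "subspace {z. z * u = u * z}"
        by (auto simp: subspace_def algebra_simps)
      show "z * z \<in> {z. z * u = u * z}" if "z \<in> {z. z * u = u * z}" for z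
        using that by (simp, metis mult.assoc)
    qed (use that in simp)
    then show ?thesis by simp
  qed
  then show ?thesis using that v by blast
qed

text \<open>This inequality carries the \<open>C\<^sup>*\<close>-identity over to commuting self-adjoint elements; it is the identity
  applied to \<open>x + \<i> y\<close>.\<close>

lemma norm_le_sum_squares:
  fixes x y :: "'a::cstar_algebra"
  assumes "star x = x" "star y = y" "x * y = y * x"
  shows "norm x * norm x \<le> norm (x * x + y * y)"
proof -
  define z where "z = x + \<i> *\<^sub>C y"
  have "star z * z = (x - \<i> *\<^sub>C y) * (x + \<i> *\<^sub>C y)"
    by (simp add: z_def star_add star_scaleC assms(1,2) scaleC_minus_left)
  also have "\<dots> = x * x + y * y"
    using assms(3) by (simp add: algebra_simps mult_scaleC_left mult_scaleC_right scaleC_add_right scaleC_diff_right)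
  finally have "norm z * norm z = norm (x * x + y * y)"
    by (metis cstar_identity power2_eq_square)
  moreover have "norm x \<le> norm z"
  proof -
    have "(2::real) *\<^sub>R x = z + star z"
      by (simp add: z_def star_add star_scaleC assms(1,2) scaleC_minus_left scaleR_2)
    then have "2 * norm x \<le> norm z + norm (star z)"
      by (metis norm_scaleR norm_triangle_ineq abs_numeral)
    then show ?thesis by simp
  qed
  ultimately show ?thesis
    by (metis mult_mono norm_ge_zero)
qed

text \<open>The norm of \<open>y\<^sup>2\<close> is an admissible \<open>r\<close> for \<open>y\<^sup>2\<close>. Since every positive element is a square, \<open>r = \<parallel>x\<parallel>\<close> is
  always admissible, and the cone is closed.\<close>

lemma pos_square_bound:
  fixes y :: "'a::cstar_algebra"
  assumes "star y = y"
  shows "norm (norm (y * y) *\<^sub>R 1 - y * y) \<le> norm (y * y)"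
proof (cases "y = 0")
  case False
  define r where "r = norm (y * y)"
  have r: "r = norm y * norm y" "r > 0"
    using assms False by (auto simp: r_def norm_selfadj_sq)
  have "norm (1 - (1 - (1/r) *\<^sub>R (y * y))) \<le> 1" using r by (simp add: norm_selfadj_sq assms)
  then have "pos (1 - (1/r) *\<^sub>R (y * y))"
    unfolding pos_def using assms by (auto simp: star_diff star_mult intro!: exI[of _ 1])
  then obtain z where z: "z * z = 1 - (1/r) *\<^sub>R (y * y)" "pos z"
     "\<And>u. (1 - (1/r) *\<^sub>R (y * y)) * u = u * (1 - (1/r) *\<^sub>R (y * y)) \<Longrightarrow> z * u = u * z"
    using pos_sqrt_commute by blast
  have zy: "z * y = y * z" by (rule z(3)) (simp add: algebra_simps)
  have "norm z * norm z \<le> norm (z * z + (sqrt (1/r) *\<^sub>R y) * (sqrt (1/r) *\<^sub>R y))"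
    by (rule norm_le_sum_squares) (simp_all add: pos_star z(2) zy assms)
  also have "\<dots> = 1" using r by (simp add: z(1))
  finally have "norm (z * z) \<le> 1" by (metis norm_selfadj_sq pos_star z(2))
  moreover have "r *\<^sub>R 1 - y * y = r *\<^sub>R (z * z)" using r by (simp add: z(1) algebra_simps)
  ultimately show ?thesis unfolding r_def[symmetric] using r(2) by (simp add: mult_le_cancel_left1)
qed simp

lemma pos_square: "star y = y \<Longrightarrow> pos (y * y)"
  using pos_square_bound[of y] by (auto simp: pos_def star_mult)

lemma pos_norm_bound: "pos x \<Longrightarrow> norm (norm x *\<^sub>R 1 - x) \<le> norm x"
  by (metis pos_sqrt_commute pos_square_bound pos_star)

lemma closed_pos: "closed {x. pos x}"
proof -
  have "{x::'a. pos x} = {x. star x = x} \<inter> {x. norm (norm x *\<^sub>R 1 - x) \<le> norm x}"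
    using pos_norm_bound by (auto simp: pos_def)
  also have "closed \<dots>"
    by (intro closed_Int closed_Collect_eq closed_Collect_le continuous_intros)
  finally show ?thesis .
qed

lemma pos_epsilon:
  assumes "\<And>e. e > 0 \<Longrightarrow> pos (x + e *\<^sub>R y)"
  shows "pos x"
proof -
  have "(\<lambda>n. x + inverse (real (Suc n)) *\<^sub>R y) \<longlonglongrightarrow> x + 0 *\<^sub>R y"
    by (intro tendsto_add tendsto_scaleR tendsto_const LIMSEQ_inverse_real_of_nat)
  from closed_sequentially[OF closed_pos _ this] assms show ?thesis by simp
qed

lemma pos_mult_commute:
  assumes "pos x" "pos y" "x * y = y * x"
  shows "pos (x * y)"
proof -
  obtain u where u: "u * u = x" "pos u" "\<And>w. x * w = w * x \<Longrightarrow> u * w = w * u"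
    using pos_sqrt_commute[OF assms(1)] by metis
  obtain v where v: "v * v = y" "pos v" "\<And>w. y * w = w * y \<Longrightarrow> v * w = w * v"
    using pos_sqrt_commute[OF assms(2)] by metis
  have uv: "u * v = v * u" using u(3)[OF assms(3)] v(3)[of u] by simp
  then have "x * y = (u * v) * (u * v)"
    using u(1) v(1) by (metis mult.assoc)
  moreover have "star (u * v) = u * v"
    unfolding star_mult pos_star[OF u(2)] pos_star[OF v(2)] by (rule uv[symmetric])
  ultimately show ?thesis using pos_square[of "u * v"] by simp
qed

lemma norm_le_of_pos:
  assumes "pos (r *\<^sub>R 1 - x)" "pos (r *\<^sub>R 1 + x)" "r \<ge> 0"
  shows "norm x \<le> r"
proof -
  have sx: "star x = x"
    using assms(1) by (simp add: pos_def star_diff)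
  have "pos ((r *\<^sub>R 1 - x) * (r *\<^sub>R 1 + x))"
    by (rule pos_mult_commute[OF assms(1,2)]) (simp add: algebra_simps)
  also have "(r *\<^sub>R 1 - x) * (r *\<^sub>R 1 + x) = (r * r) *\<^sub>R 1 - x * x"
    by (simp add: algebra_simps)
  finally obtain z where z: "z * z = (r * r) *\<^sub>R 1 - x * x" "pos z"
    "\<And>w. ((r * r) *\<^sub>R 1 - x * x) * w = w * ((r * r) *\<^sub>R 1 - x * x) \<Longrightarrow> z * w = w * z"
    using pos_sqrt_commute by blast
  have "z * x = x * z" by (rule z(3)) (simp add: algebra_simps)
  then have "norm x * norm x \<le> norm (x * x + z * z)"
    by (intro norm_le_sum_squares) (simp_all add: pos_star z(2) sx)
  also have "\<dots> = r * r" using z(1) by simp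
  finally show ?thesis using assms(3) by (metis power2_eq_square power2_le_imp_le)
qed

lemma pos_conj:
  assumes "pos x" "star k = k" shows "\<exists>y. k * x * k = star y * y"
proof -
  obtain v where v: "v * v = x" "pos v" using pos_sqrt[OF assms(1)] by metis
  then have "k * x * k = star (v * k) * (v * k)"
    by (simp only: star_mult pos_star[OF v(2)] assms(2) mult.assoc flip: v(1))
  then show ?thesis by blast
qed

lemma pos_invertible_bound:
  assumes "pos b" "b * d = 1" "d * b = 1"
  shows "\<exists>\<delta>>0. pos (b - \<delta> *\<^sub>R 1)"
proof -
  have sd: "star d = d"
  proof -
    have "star d * b = 1" using assms(1,2) by (metis pos_star star_mult star_one)
    then show ?thesis by (metis assms(2) mult.assoc mult.left_neutral mult.right_neutral)
  qed
  have d0: "norm d > 0" using assms(2) by auto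
  have "pos (d * d * b)"
    by (rule pos_mult_commute[OF pos_square[OF sd] assms(1)]) (metis assms(2,3) mult.assoc)
  then have "pos d" using assms(3) by (simp add: mult.assoc)
  have "pos ((norm d *\<^sub>R 1 - d) * b)"
    by (rule pos_mult_commute[OF pos_norm_diff(1)[OF sd] assms(1)])
      (auto simp: algebra_simps assms)
  then have "pos ((1 / norm d) *\<^sub>R (norm d *\<^sub>R b - 1))"
    using d0 by (intro pos_scaleR) (auto simp: algebra_simps assms)
  also have "(1 / norm d) *\<^sub>R (norm d *\<^sub>R b - 1) = b - (1 / norm d) *\<^sub>R 1"
    using d0 by (simp add: algebra_simps)
  finally show ?thesis using d0 by (intro exI[of _ "1 / norm d"]) simp
qed

lemma invertible_near_one:
  fixes x :: "'a::{real_normed_algebra_1,banach}"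
  assumes "norm (1 - x) < 1"
  shows "\<exists>d. x * d = 1 \<and> d * x = 1"
proof -
  define w where "w = 1 - x"
  have s: "summable (\<lambda>n. w ^ n)"
    using assms by (intro complete_algebra_summable_geometric) (simp add: w_def)
  have "(\<Sum>n. w ^ n) = w ^ 0 + (\<Sum>n. w ^ Suc n)"
    using suminf_split_head[OF s] by simp
  then have *: "(\<Sum>n. w ^ n) - (\<Sum>n. w ^ Suc n) = 1" by simp
  have "(\<Sum>n. w ^ Suc n) = w * (\<Sum>n. w ^ n)" by (simp add: suminf_mult[OF s])
  moreover have "(\<Sum>n. w ^ Suc n) = (\<Sum>n. w ^ n) * w"
    unfolding power_Suc2 by (simp add: suminf_mult2[OF s])
  ultimately have "(1 - w) * (\<Sum>n. w ^ n) = 1" "(\<Sum>n. w ^ n) * (1 - w) = 1"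
    using * by (simp_all add: algebra_simps)
  then show ?thesis by (intro exI[of _ "\<Sum>n. w ^ n"]) (simp add: w_def)
qed

lemma pos_shift_invertible:
  assumes "pos q" "l > 0"
  shows "\<exists>d. (l *\<^sub>R 1 + q) * d = 1 \<and> d * (l *\<^sub>R 1 + q) = 1"
proof -
  obtain r where r: "norm (r *\<^sub>R 1 - q) \<le> r" using assms(1) by (auto simp: pos_def)
  then have r0: "r \<ge> 0" using norm_ge_zero order_trans by blast
  define x where "x = (1 / (r + l)) *\<^sub>R (l *\<^sub>R 1 + q)"
  have "1 - x = (1 / (r + l)) *\<^sub>R ((r + l) *\<^sub>R 1 - (l *\<^sub>R 1 + q))"
    using r0 assms(2) by (simp add: x_def scaleR_diff_right)
  also have "(r + l) *\<^sub>R 1 - (l *\<^sub>R 1 + q) = r *\<^sub>R 1 - q" by (simp add: algebra_simps)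
  finally have "norm (1 - x) = norm (r *\<^sub>R 1 - q) / (r + l)" using r0 assms(2) by simp
  also have "\<dots> < 1" using r r0 assms(2) by (simp add: divide_less_eq)
  finally obtain d where "x * d = 1" "d * x = 1" using invertible_near_one by blast
  then show ?thesis
    by (intro exI[of _ "(1 / (r + l)) *\<^sub>R d"]) (simp add: x_def)
qed

section \<open>Positivity of \<open>y\<^sup>* y\<close>\<close>

text \<open>If \<open>p = - z\<^sup>* z\<close> is positive then so is \<open>z z\<^sup>*\<close>, because \<open>z\<^sup>* z + z z\<^sup>* = 2 u\<^sup>2 + 2 v\<^sup>2\<close> for the
  real part \<open>u\<close> and imaginary part \<open>v\<close> of \<open>z\<close>. Thus \<open>r + z z\<^sup>*\<close> is invertible for \<open>r > 0\<close>, hence so is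
  \<open>r + z\<^sup>* z = r - p\<close>; if \<open>r = \<parallel>p\<parallel> > 0\<close>, then \<open>r - p\<close> is positive and invertible, so
  \<open>p \<le> r - \<delta>\<close> for some \<open>\<delta> > 0\<close>, which contradicts \<open>\<parallel>p\<parallel> = r\<close>. Hence \<open>p = 0\<close>.\<close>

lemma eq_zero_if_neg_star_mult_pos:
  fixes z :: "'a::cstar_algebra"
  assumes "pos (- (star z * z))"
  shows "z = 0"
proof -
  define u v where "u = re_part z" and "v = im_part z"
  have su: "star u = u" and sv: "star v = v" by (simp_all add: u_def v_def)
  have z: "z = u + \<i> *\<^sub>C v" unfolding u_def v_def by (rule re_im_decompose)
  have sz: "star z = u - \<i> *\<^sub>C v"
    by (simp add: z star_add star_scaleC su sv scaleC_minus_left)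
  have "z * star z = 2 *\<^sub>R (u * u) + 2 *\<^sub>R (v * v) + - (star z * z)"
    unfolding sz by (subst (1 2) z) (simp add: algebra_simps mult_scaleC_left mult_scaleC_right scaleR_2 scaleC_add_right scaleC_diff_right)
  then have q: "pos (z * star z)"
    using su sv assms by (simp only:) (intro pos_add pos_scaleR pos_square, auto)
  define p where "p = - (star z * z)"
  have p: "pos p" using assms by (simp add: p_def)
  have "norm p = 0"
  proof (rule ccontr)
    assume "norm p \<noteq> 0"
    define r where "r = norm p"
    have r: "r > 0" using \<open>norm p \<noteq> 0\<close> by (simp add: r_def)
    obtain d where d: "(r *\<^sub>R 1 + z * star z) * d = 1" "d * (r *\<^sub>R 1 + z * star z) = 1"
      using pos_shift_invertible[OF q r] by blast
    have d1: "z * star z * d = 1 - r *\<^sub>R d" "d * (z * star z) = 1 - r *\<^sub>R d"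
      using d by (simp_all add: algebra_simps eq_diff_eq)
    \<comment> \<open>The usual transfer of an inverse from \<open>r + z z\<^sup>*\<close> to \<open>r + z\<^sup>* z\<close>.\<close>
    define e where "e = (1 / r) *\<^sub>R (1 - star z * d * z)"
    have rp: "r *\<^sub>R 1 - p = r *\<^sub>R 1 + star z * z" by (simp add: p_def)
    have "star z * z * (star z * d * z) = star z * (z * star z * d) * z"
      by (simp add: mult.assoc)
    also have "\<dots> = star z * z - r *\<^sub>R (star z * d * z)"
      unfolding d1 by (simp add: algebra_simps)
    finally have A: "star z * z * (star z * d * z) = star z * z - r *\<^sub>R (star z * d * z)" .
    have "(star z * d * z) * (star z * z) = star z * (d * (z * star z)) * z"
      by (simp add: mult.assoc)
    also have "\<dots> = star z * z - r *\<^sub>R (star z * d * z)"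
      unfolding d1 by (simp add: algebra_simps)
    finally have B: "(star z * d * z) * (star z * z) = star z * z - r *\<^sub>R (star z * d * z)" .
    have gen: "(r *\<^sub>R 1 + c) * (1 - m) = r *\<^sub>R 1" "(1 - m) * (r *\<^sub>R 1 + c) = r *\<^sub>R 1"
      if "c * m = c - r *\<^sub>R m" "m * c = c - r *\<^sub>R m" for c m :: 'a
      using that by (simp_all add: left_diff_distrib right_diff_distrib distrib_left distrib_right scaleR_diff_right)
    have "(r *\<^sub>R 1 - p) * e = 1" "e * (r *\<^sub>R 1 - p) = 1"
      unfolding rp e_def mult_scaleR_right mult_scaleR_left gen[OF A B] using r by simp_all
    moreover have "pos (r *\<^sub>R 1 - p)"
      using pos_norm_diff(1)[of p r] p by (simp add: r_def pos_star)
    ultimately obtain \<delta> where \<delta>: "\<delta> > 0" "pos (r *\<^sub>R 1 - p - \<delta> *\<^sub>R 1)"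
      using pos_invertible_bound by blast
    define s where "s = max 0 (r - \<delta>)"
    have eq: "s *\<^sub>R 1 - p = (r *\<^sub>R 1 - p - \<delta> *\<^sub>R 1) + (s - (r - \<delta>)) *\<^sub>R 1"
      by (simp add: algebra_simps)
    have "pos (s *\<^sub>R 1 - p)"
      unfolding eq by (intro pos_add \<delta> pos_const) (simp add: s_def)
    moreover have "pos (s *\<^sub>R 1 + p)"
      by (intro pos_add p pos_const) (simp add: s_def)
    ultimately have "norm p \<le> s"
      by (rule norm_le_of_pos) (simp add: s_def)
    then show False using r \<delta>(1) unfolding r_def s_def by linarith
  qed
  then have "norm (star z * z) = 0" by (simp add: p_def)
  then show "z = 0" by (simp add: cstar_identity)
qed

text \<open>With \<open>c = y\<^sup>* y\<close> and \<open>v = \<bar>c\<bar>\<close>, the element \<open>e = v - c\<close> is twice the negative part of \<open>c\<close>. It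
  satisfies \<open>(y e)\<^sup>* (y e) = - v e\<^sup>2\<close>, so the preceding lemma yields \<open>y e = 0\<close>, whence \<open>e = 0\<close>.\<close>

theorem pos_star_mult:
  fixes y :: "'a::cstar_algebra"
  shows "pos (star y * y)"
proof -
  define c where "c = star y * y"
  have sc: "star c = c" by (simp add: c_def star_mult star_star)
  obtain v where v: "v * v = c * c" "pos v" "\<And>u. c * c * u = u * (c * c) \<Longrightarrow> v * u = u * v"
    using pos_sqrt_commute[OF pos_square[OF sc]] by metis
  have vc: "v * c = c * v" by (rule v(3)) (simp add: mult.assoc)
  define e where "e = v - c"
  have se: "star e = e" by (simp add: e_def star_diff pos_star v(2) sc)
  have ce: "c * e = - (v * e)" by (simp add: e_def algebra_simps v(1) vc)
  have ve: "v * e = e * v" by (simp add: e_def algebra_simps vc)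
  have "star (y * e) * (y * e) = e * (c * e)"
    by (simp add: star_mult se c_def mult.assoc)
  also have "\<dots> = - (v * (e * e))" by (simp add: ce) (metis mult.assoc ve)
  finally have z: "star (y * e) * (y * e) = - (v * (e * e))" .
  have "pos (v * (e * e))"
    by (rule pos_mult_commute[OF v(2) pos_square[OF se]]) (metis mult.assoc ve)
  then have "y * e = 0" by (intro eq_zero_if_neg_star_mult_pos) (simp add: z)
  then have vee: "v * (e * e) = 0" using z by simp
  have "c * (e * e) = 0" using ce vee by (metis mult.assoc mult_minus_left neg_equal_0_iff_equal)
  then have "e * (e * e) = 0" using vee by (simp add: e_def left_diff_distrib)
  then have "(e * e) * (e * e) = 0" by (simp add: mult.assoc)
  moreover have "norm ((e * e) * (e * e)) = norm (e * e) * norm (e * e)"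
    by (rule norm_selfadj_sq) (simp add: star_mult se)
  ultimately have "norm e * norm e = 0" using norm_selfadj_sq[OF se] by simp
  then have "c = v" by (simp add: e_def)
  then show ?thesis using v(2) by (simp add: c_def)
qed

section \<open>Real characters from maximal modules\<close>

text \<open>The self-adjoint part of a commutative unital \<open>C\<^sup>*\<close>-algebra, as a closed real algebra.\<close>

locale sa_comm_algebra =
  fixes H :: "'a::cstar_algebra set"
  assumes closed_H: "closed H" and subspace_H: "subspace H" and one_H [simp]: "1 \<in> H"
    and mult_H: "\<And>x y. x \<in> H \<Longrightarrow> y \<in> H \<Longrightarrow> x * y \<in> H"
    and comm_H: "\<And>x y. x \<in> H \<Longrightarrow> y \<in> H \<Longrightarrow> x * y = y * x"
    and star_H: "\<And>x. x \<in> H \<Longrightarrow> star x = x"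
begin

text \<open>Unital real algebra homomorphisms from \<open>H\<close> to the reals; values outside \<open>H\<close> are irrelevant.\<close>

definition real_character :: "('a \<Rightarrow> real) \<Rightarrow> bool" where
  "real_character \<omega> \<longleftrightarrow>
     (\<forall>x\<in>H. \<forall>y\<in>H. \<omega> (x + y) = \<omega> x + \<omega> y \<and> \<omega> (x * y) = \<omega> x * \<omega> y) \<and>
     (\<forall>r. \<forall>x\<in>H. \<omega> (r *\<^sub>R x) = r * \<omega> x) \<and> \<omega> 1 = 1"

text \<open>Proper modules over the cone of positive elements of \<open>H\<close>: they contain this cone, are closed under addition and
  under multiplication by it, and do not contain \<open>-1\<close>. They are candidates for the set of
  elements on which a given character is non-negative.\<close>

definition proper_module :: "'a set \<Rightarrow> bool" where
  "proper_module M \<longleftrightarrow> M \<subseteq> H \<and> (\<forall>p\<in>H. pos p \<longrightarrow> p \<in> M) \<and> (\<forall>m\<in>M. \<forall>n\<in>M. m + n \<in> M) \<and>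
     (\<forall>p\<in>H. \<forall>m\<in>M. pos p \<longrightarrow> p * m \<in> M) \<and> - 1 \<notin> M"

lemma add_H: "x \<in> H \<Longrightarrow> y \<in> H \<Longrightarrow> x + y \<in> H"
  and diff_H: "x \<in> H \<Longrightarrow> y \<in> H \<Longrightarrow> x - y \<in> H"
  and minus_H: "x \<in> H \<Longrightarrow> - x \<in> H"
  and scaleR_H: "x \<in> H \<Longrightarrow> r *\<^sub>R x \<in> H"
  and zero_H [simp]: "0 \<in> H"
  using subspace_H by (auto intro: subspace_add subspace_diff subspace_neg subspace_scale subspace_0)

lemmas H_intros = add_H diff_H minus_H scaleR_H zero_H mult_H one_H

lemma pos_mult_H: "p \<in> H \<Longrightarrow> q \<in> H \<Longrightarrow> pos p \<Longrightarrow> pos q \<Longrightarrow> pos (p * q)"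
  by (intro pos_mult_commute comm_H)

lemma maximal_module:
  assumes "proper_module M0"
  obtains M where "proper_module M" "M0 \<subseteq> M" "\<And>N. proper_module N \<Longrightarrow> M \<subseteq> N \<Longrightarrow> N = M"
proof -
  let ?A = "{M. proper_module M \<and> M0 \<subseteq> M}"
  have "\<exists>M\<in>?A. \<forall>X\<in>?A. M \<subseteq> X \<longrightarrow> X = M"
  proof (rule subset_Zorn_nonempty)
    show "?A \<noteq> {}" using assms by blast
    fix \<C> assume C: "\<C> \<noteq> {}" "subset.chain ?A \<C>"
    have pm: "proper_module M" and M0: "M0 \<subseteq> M" if "M \<in> \<C>" for M
      using C(2) that by (auto simp: subset.chain_def)
    have ch: "M \<subseteq> N \<or> N \<subseteq> M" if "M \<in> \<C>" "N \<in> \<C>" for M N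
      using C(2) that unfolding subset_chain_def by blast
    have "proper_module (\<Union>\<C>)"
      unfolding proper_module_def
    proof (intro conjI ballI impI)
      show "\<Union>\<C> \<subseteq> H" using pm by (force simp: proper_module_def)
      show "p \<in> \<Union>\<C>" if "p \<in> H" "pos p" for p
        using C(1) pm that by (force simp: proper_module_def)
      show "p * m \<in> \<Union>\<C>" if "p \<in> H" "m \<in> \<Union>\<C>" "pos p" for p m
        using that pm by (auto simp: proper_module_def)
      show "- 1 \<notin> \<Union>\<C>" using pm by (auto simp: proper_module_def)
      fix m n assume "m \<in> \<Union>\<C>" "n \<in> \<Union>\<C>"
      then obtain M N where MN: "m \<in> M" "n \<in> N" "M \<in> \<C>" "N \<in> \<C>" by blast
      with ch[OF MN(3,4)] obtain L where "m \<in> L" "n \<in> L" "L \<in> \<C>" by blast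
      then show "m + n \<in> \<Union>\<C>" using pm[of L] unfolding proper_module_def by blast
    qed
    then show "\<Union>\<C> \<in> ?A" using C(1) M0 by auto
  qed
  then obtain M where M: "M \<in> ?A" "\<forall>X\<in>?A. M \<subseteq> X \<longrightarrow> X = M"
    by (rule bexE)
  show ?thesis
  proof (rule that[of M])
    show "proper_module M" "M0 \<subseteq> M" using M(1) by auto
    then show "N = M" if "proper_module N" "M \<subseteq> N" for N
      using M(2) that by auto
  qed
qed

context
  fixes M
  assumes pm: "proper_module M"
    and max: "\<And>N. proper_module N \<Longrightarrow> M \<subseteq> N \<Longrightarrow> N = M"
begin

lemma M_H: "x \<in> M \<Longrightarrow> x \<in> H" and M_pos: "p \<in> H \<Longrightarrow> pos p \<Longrightarrow> p \<in> M"
  and M_add: "x \<in> M \<Longrightarrow> y \<in> M \<Longrightarrow> x + y \<in> M"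
  and M_mult: "p \<in> H \<Longrightarrow> pos p \<Longrightarrow> x \<in> M \<Longrightarrow> p * x \<in> M"
  and M_proper: "- 1 \<notin> M"
  using pm by (auto simp: proper_module_def)

lemma M_const: "c \<ge> 0 \<Longrightarrow> c *\<^sub>R 1 \<in> M"
  by (intro M_pos pos_const H_intros)

lemma M_scaleR: "c \<ge> 0 \<Longrightarrow> x \<in> M \<Longrightarrow> c *\<^sub>R x \<in> M"
  using M_mult[of "c *\<^sub>R 1" x] by (auto intro: H_intros pos_const)

lemma M_const_nonneg:
  assumes "c *\<^sub>R 1 \<in> M" shows "c \<ge> 0"
proof (rule ccontr)
  assume "\<not> c \<ge> 0"
  then have "(1 / (- c)) *\<^sub>R (c *\<^sub>R 1) \<in> M" by (intro M_scaleR assms) auto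
  then show False using M_proper \<open>\<not> c \<ge> 0\<close> by simp
qed

lemma M_extend:
  assumes x: "x \<in> H" "x \<notin> M"
  obtains m p where "m \<in> M" "p \<in> H" "pos p" "m + p * x = - 1"
proof (rule ccontr)
  assume contr: "\<not> thesis"
  let ?N = "{m + p * x | m p. m \<in> M \<and> p \<in> H \<and> pos p}"
  have sub: "M \<subseteq> ?N"
  proof
    fix m assume "m \<in> M"
    then have "m = m + 0 * x \<and> m \<in> M \<and> 0 \<in> H \<and> pos 0" by simp
    then show "m \<in> ?N" by blast
  qed
  have "x = 0 + 1 * x \<and> 0 \<in> M \<and> 1 \<in> H \<and> pos 1" using M_pos[of 0] by simp
  then have xN: "x \<in> ?N" by blast
  have "proper_module ?N"
    unfolding proper_module_def
  proof (intro conjI ballI impI)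
    show "?N \<subseteq> H" using M_H x by (auto intro: H_intros)
    show "p \<in> ?N" if "p \<in> H" "pos p" for p using that sub M_pos by blast
    show "- 1 \<notin> ?N" using contr that by force
    show "u + v \<in> ?N" if uv: "u \<in> ?N" "v \<in> ?N" for u v
    proof -
      obtain m p n q where "u = m + p * x" "v = n + q * x" "m \<in> M" "n \<in> M" "p \<in> H" "q \<in> H"
         "pos p" "pos q" using uv by blast
      then have "u + v = (m + n) + (p + q) * x \<and> m + n \<in> M \<and> p + q \<in> H \<and> pos (p + q)"
        by (auto simp: algebra_simps intro: M_add H_intros pos_add)
      then show ?thesis by blast
    qed
    show "r * u \<in> ?N" if ru: "r \<in> H" "u \<in> ?N" "pos r" for r u
    proof -
      obtain m p where "u = m + p * x" "m \<in> M" "p \<in> H" "pos p" using ru by blast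
      then have "r * u = r * m + (r * p) * x \<and> r * m \<in> M \<and> r * p \<in> H \<and> pos (r * p)"
        using ru by (auto simp: algebra_simps intro: M_mult H_intros pos_mult_H)
      then show ?thesis by blast
    qed
  qed
  then have "?N = M" using sub max by blast
  then show False using xN x by blast
qed

lemma pos_diff_H: "x \<in> H \<Longrightarrow> norm x \<le> r \<Longrightarrow> pos (r *\<^sub>R 1 - x)"
  and pos_sum_H: "x \<in> H \<Longrightarrow> norm x \<le> r \<Longrightarrow> pos (r *\<^sub>R 1 + x)"
  by (simp_all add: star_H pos_norm_diff)

text \<open>A maximal proper module orders \<open>H\<close> like the real numbers: it is closed, it contains \<open>x\<close> or \<open>- x\<close>
  for each \<open>x\<close>, and modulo the ideal of those \<open>x\<close> for which it contains both \<open>x\<close> and \<open>- x\<close>, every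
  element of \<open>H\<close> is a real constant.\<close>

lemma M_closed:
  assumes x: "x \<in> H" "\<And>e. e > 0 \<Longrightarrow> x + e *\<^sub>R 1 \<in> M"
  shows "x \<in> M"
proof (rule ccontr)
  assume "x \<notin> M"
  then obtain m p where m: "m \<in> M" "p \<in> H" "pos p" "m + p * x = - 1"
    using M_extend[OF x(1)] by blast
  define e where "e = 1 / (2 * (norm p + 1))"
  have e: "e > 0" "e * norm p \<le> 1/2" by (auto simp: e_def field_simps add_pos_nonneg)
  have "m + p * (x + e *\<^sub>R 1) \<in> M" by (intro M_add m M_mult x(2) e(1))
  moreover have "(1/2) *\<^sub>R 1 - e *\<^sub>R p \<in> M"
    using e by (intro M_pos H_intros pos_diff_H m) auto
  ultimately have "m + p * (x + e *\<^sub>R 1) + ((1/2) *\<^sub>R 1 - e *\<^sub>R p) \<in> M" by (rule M_add)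
  also have "m + p * (x + e *\<^sub>R 1) + ((1/2) *\<^sub>R 1 - e *\<^sub>R p) = (m + p * x) + (1/2) *\<^sub>R 1"
    by (simp add: algebra_simps)
  also have "\<dots> = (- (1/2)) *\<^sub>R 1"
    unfolding m(4) using scaleR_left_diff_distrib[of "1/2" 1 "1::'a"] by simp
  finally show False using M_const_nonneg by fastforce
qed

lemma M_total:
  assumes x: "x \<in> H" shows "x \<in> M \<or> - x \<in> M"
proof (rule ccontr)
  assume "\<not> (x \<in> M \<or> - x \<in> M)"
  then have nx: "x \<notin> M" "- x \<notin> M" by auto
  obtain m p where m: "m \<in> M" "p \<in> H" "pos p" "m + p * x = - 1"
    using M_extend[OF x nx(1)] by blast
  obtain n q where n: "n \<in> M" "q \<in> H" "pos q" "n + q * - x = - 1"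
    using M_extend[OF minus_H[OF x] nx(2)] by blast
  have px: "p * x = - 1 - m" using m(4) by (metis add_diff_cancel_left')
  have qx: "q * x = 1 + n" using n(4) by (simp add: algebra_simps eq_diff_eq)
  have "q * (p * x) = p * (q * x)"
    by (metis comm_H m(2) mult.assoc n(2))
  then have h: "q * (- 1 - m) = p * (1 + n)" by (simp only: px qx)
  have "p + (q + q * m + p * n) = p * (1 + n) - q * (- 1 - m)" by (simp add: algebra_simps)
  then have "- p = q + q * m + p * n" by (intro minus_unique) (simp add: h)
  also have "\<dots> \<in> M" by (intro M_add M_mult M_pos n m)
  finally have np: "- p \<in> M" .
  \<comment> \<open>As \<open>M\<close> contains \<open>p\<close> and \<open>- p\<close>, it contains \<open>p x\<close>, since \<open>x\<close> becomes positive after adding a constant.\<close>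
  have "(norm x *\<^sub>R 1 + x) * p + norm x *\<^sub>R (- p) \<in> M"
    by (intro M_add M_mult M_scaleR np H_intros pos_sum_H x M_pos m) auto
  also have "(norm x *\<^sub>R 1 + x) * p + norm x *\<^sub>R (- p) = p * x"
    by (simp add: algebra_simps comm_H[OF x m(2)])
  finally have "m + p * x \<in> M" by (intro M_add m)
  then show False using m(4) M_proper by simp
qed

lemma M_value_unique:
  assumes "x - c *\<^sub>R 1 \<in> M" "d *\<^sub>R 1 - x \<in> M" shows "c \<le> d"
proof -
  have "(x - c *\<^sub>R 1) + (d *\<^sub>R 1 - x) \<in> M" by (intro M_add assms)
  also have "(x - c *\<^sub>R 1) + (d *\<^sub>R 1 - x) = (d - c) *\<^sub>R 1" by (simp add: algebra_simps)
  finally show ?thesis using M_const_nonneg by force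
qed

lemma M_value_exists:
  assumes x: "x \<in> H" shows "\<exists>c. x - c *\<^sub>R 1 \<in> M \<and> c *\<^sub>R 1 - x \<in> M"
proof -
  define Q where "Q = {q. x - q *\<^sub>R 1 \<in> M}"
  have up: "norm x *\<^sub>R 1 - x \<in> M" by (intro M_pos pos_diff_H x H_intros) simp
  have "x - (- norm x) *\<^sub>R 1 \<in> M"
    using M_pos[OF _ pos_sum_H[OF x order_refl]] x by (auto simp: add.commute intro: H_intros)
  then have ne: "Q \<noteq> {}" unfolding Q_def by blast
  have bd: "bdd_above Q"
    using M_value_unique[OF _ up] by (auto simp: Q_def intro!: bdd_aboveI[of _ "norm x"])
  define c where "c = Sup Q"
  have cx: "x - c *\<^sub>R 1 \<in> H" "c *\<^sub>R 1 - x \<in> H"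
    by (simp_all add: x diff_H scaleR_H)
  have lower: "x - c *\<^sub>R 1 + e *\<^sub>R 1 \<in> M" if e: "e > 0" for e
  proof -
    obtain q where q: "q \<in> Q" "c - e < q"
      using less_cSup_iff[OF ne bd, of "c - e"] e by (auto simp: c_def)
    then have "(x - q *\<^sub>R 1) + (q - (c - e)) *\<^sub>R 1 \<in> M"
      by (intro M_add M_const) (auto simp: Q_def)
    then show ?thesis by (simp add: algebra_simps)
  qed
  have upper: "c *\<^sub>R 1 - x + e *\<^sub>R 1 \<in> M" if "e > 0" for e
  proof -
    have "c + e \<notin> Q" using cSup_upper[OF _ bd, of "c + e"] that by (auto simp: c_def)
    then have "- (x - (c + e) *\<^sub>R 1) \<in> M"
      using M_total[of "x - (c + e) *\<^sub>R 1"] x by (auto simp: Q_def intro: H_intros)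
    then show ?thesis by (simp add: algebra_simps)
  qed
  show ?thesis using M_closed[OF cx(1) lower] M_closed[OF cx(2) upper] by blast
qed

lemma M_ideal:
  assumes "x \<in> M" "- x \<in> M" "y \<in> H" shows "y * x \<in> M \<and> - (y * x) \<in> M"
proof -
  have "(norm y *\<^sub>R 1 + y) * u + norm y *\<^sub>R (- u) \<in> M" if "u \<in> M" "- u \<in> M" for u
    by (intro M_add M_mult M_scaleR that H_intros pos_sum_H assms) auto
  then have "y * u \<in> M" if "u \<in> M" "- u \<in> M" for u
    using that by (simp add: algebra_simps)
  from this[of x] this[of "- x"] show ?thesis using assms by simp
qed

text \<open>The constant to which an element is congruent modulo the ideal of \<open>M\<close>; for elements of \<open>H\<close> it exists and is
  unique.\<close>

definition value_at :: "'a \<Rightarrow> real" where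
  "value_at x = (THE c. x - c *\<^sub>R 1 \<in> M \<and> c *\<^sub>R 1 - x \<in> M)"

lemma value_at_eq:
  assumes "x - c *\<^sub>R 1 \<in> M" "- (x - c *\<^sub>R 1) \<in> M" shows "value_at x = c"
  unfolding value_at_def
proof (rule the_equality)
  show "x - c *\<^sub>R 1 \<in> M \<and> c *\<^sub>R 1 - x \<in> M" using assms by simp
  fix d assume "x - d *\<^sub>R 1 \<in> M \<and> d *\<^sub>R 1 - x \<in> M"
  then show "d = c" using M_value_unique[of x d c] M_value_unique[of x c d] assms by simp
qed

lemma value_at:
  assumes "x \<in> H" shows "x - value_at x *\<^sub>R 1 \<in> M" "- (x - value_at x *\<^sub>R 1) \<in> M"
proof -
  obtain c where c: "x - c *\<^sub>R 1 \<in> M" "- (x - c *\<^sub>R 1) \<in> M"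
    using M_value_exists[OF assms] by auto
  then show "x - value_at x *\<^sub>R 1 \<in> M" "- (x - value_at x *\<^sub>R 1) \<in> M"
    unfolding value_at_eq[OF c] by auto
qed

lemma real_character_value_at: "real_character value_at"
  unfolding real_character_def
proof (intro conjI ballI allI)
  show "value_at 1 = 1" using M_pos[of 0] by (intro value_at_eq) auto
  fix x assume x: "x \<in> H"
  define u where "u = x - value_at x *\<^sub>R 1"
  have u: "u \<in> M" "- u \<in> M" using value_at[OF x] by (auto simp: u_def)
  show "value_at (r *\<^sub>R x) = r * value_at x" for r
  proof -
    have eq: "r *\<^sub>R x - (r * value_at x) *\<^sub>R 1 = (r *\<^sub>R 1) * u" by (simp add: u_def algebra_simps)
    show ?thesis
      using M_ideal[OF u, of "r *\<^sub>R 1"] by (intro value_at_eq) (auto simp only: eq intro: H_intros)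
  qed
  fix y assume y: "y \<in> H"
  define v where "v = y - value_at y *\<^sub>R 1"
  have v: "v \<in> M" "- v \<in> M" using value_at[OF y] by (auto simp: v_def)
  show "value_at (x + y) = value_at x + value_at y"
  proof (rule value_at_eq)
    have eq: "x + y - (value_at x + value_at y) *\<^sub>R 1 = u + v"
      by (simp add: u_def v_def algebra_simps)
    show "x + y - (value_at x + value_at y) *\<^sub>R 1 \<in> M" unfolding eq by (intro M_add u v)
    have "- u + - v \<in> M" by (intro M_add u v)
    then show "- (x + y - (value_at x + value_at y) *\<^sub>R 1) \<in> M" unfolding eq by simp
  qed
  show "value_at (x * y) = value_at x * value_at y"
  proof (rule value_at_eq)
    have eq: "x * y - (value_at x * value_at y) *\<^sub>R 1 = y * u + (value_at x *\<^sub>R 1) * v"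
      by (simp add: u_def v_def algebra_simps comm_H[OF x y])
    note yu = M_ideal[OF u y] and xv = M_ideal[OF v scaleR_H[OF one_H], of "value_at x"]
    show "x * y - (value_at x * value_at y) *\<^sub>R 1 \<in> M"
      unfolding eq by (intro M_add conjunct1[OF yu] conjunct1[OF xv])
    have "- (y * u) + - ((value_at x *\<^sub>R 1) * v) \<in> M"
      by (intro M_add conjunct2[OF yu] conjunct2[OF xv])
    then show "- (x * y - (value_at x * value_at y) *\<^sub>R 1) \<in> M" unfolding eq by simp
  qed
qed

end

text \<open>If no equation \<open>q b = 1 + p\<close> held with positive \<open>p\<close> and \<open>q\<close>, then the elements \<open>p - q b\<close> would form a proper
  module, and a maximal one above it would give a character that is not positive at \<open>b\<close>.\<close>

lemma positivity_certificate:
  assumes b: "b \<in> H" and om: "\<And>\<omega>. real_character \<omega> \<Longrightarrow> \<omega> b > 0"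
  shows "\<exists>p q. p \<in> H \<and> q \<in> H \<and> pos p \<and> pos q \<and> q * b = 1 + p"
proof (rule ccontr)
  assume contr: "\<not> ?thesis"
  let ?N = "{p - q * b | p q. p \<in> H \<and> q \<in> H \<and> pos p \<and> pos q}"
  have "proper_module ?N"
    unfolding proper_module_def
  proof (intro conjI ballI impI)
    show "?N \<subseteq> H" using b by (auto intro: H_intros)
    show "p \<in> ?N" if "p \<in> H" "pos p" for p
    proof -
      have "p = p - 0 * b \<and> p \<in> H \<and> 0 \<in> H \<and> pos p \<and> pos 0" using that by simp
      then show ?thesis by blast
    qed
    show "- 1 \<notin> ?N"
    proof
      assume "- 1 \<in> ?N"
      then obtain p q where "- 1 = p - q * b" "p \<in> H" "q \<in> H" "pos p" "pos q" by blast
      moreover from this(1) have "q * b = 1 + p" by (simp add: algebra_simps eq_diff_eq)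
      ultimately show False using contr by blast
    qed
    show "u + v \<in> ?N" if uv: "u \<in> ?N" "v \<in> ?N" for u v
    proof -
      obtain m p n q where "u = m - p * b" "v = n - q * b" "m \<in> H" "n \<in> H" "p \<in> H" "q \<in> H"
         "pos p" "pos q" "pos m" "pos n" using uv by blast
      then have "u + v = (m + n) - (p + q) * b \<and> m + n \<in> H \<and> p + q \<in> H \<and> pos (m + n) \<and> pos (p + q)"
        by (auto simp: algebra_simps intro: H_intros pos_add)
      then show ?thesis by blast
    qed
    show "r * u \<in> ?N" if ru: "r \<in> H" "u \<in> ?N" "pos r" for r u
    proof -
      obtain m p where "u = m - p * b" "m \<in> H" "p \<in> H" "pos m" "pos p" using ru by blast
      then have "r * u = r * m - (r * p) * b \<and> r * m \<in> H \<and> r * p \<in> H \<and> pos (r * m) \<and> pos (r * p)"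
        using ru by (auto simp: algebra_simps intro: H_intros pos_mult_H)
      then show ?thesis by blast
    qed
  qed
  then obtain M where M: "proper_module M" "?N \<subseteq> M" "\<And>N. proper_module N \<Longrightarrow> M \<subseteq> N \<Longrightarrow> N = M"
    using maximal_module by blast
  have "0 *\<^sub>R 1 - b = 0 - 1 * b \<and> 0 \<in> H \<and> 1 \<in> H \<and> pos 0 \<and> pos 1" by simp
  then have "0 *\<^sub>R 1 - b \<in> ?N" by blast
  then have "0 *\<^sub>R 1 - b \<in> M" using M(2) by blast
  from M_value_unique[OF M(1,3) value_at(1)[OF M(1,3) b] this]
  have "value_at M b \<le> 0" by blast
  moreover have "real_character (value_at M)" using real_character_value_at[OF M(1,3)] by blast
  ultimately show False using om by force
qed

text \<open>The equation \<open>q b = 1 + p\<close> alone does not show at once that \<open>b\<close> is positive. With \<open>r \<ge> \<parallel>q\<parallel>\<close>, however, a bound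
  \<open>b + s \<ge> 0\<close> for some \<open>s \<ge> 0\<close> improves to \<open>b + s - 1/r \<ge> 0\<close>, and finitely many such steps starting from
  \<open>s = \<parallel>b\<parallel>\<close> lead to \<open>b \<ge> 0\<close>; one more step gives \<open>b \<ge> 1/r\<close>.\<close>

lemma pos_of_characters_strict:
  assumes b: "b \<in> H" and om: "\<And>\<omega>. real_character \<omega> \<Longrightarrow> \<omega> b > 0"
  shows "\<exists>\<delta>>0. pos (b - \<delta> *\<^sub>R 1)"
proof -
  have "\<exists>p q. p \<in> H \<and> q \<in> H \<and> pos p \<and> pos q \<and> q * b = 1 + p"
    by (intro positivity_certificate b om)
  then obtain p q where pq: "p \<in> H" "q \<in> H" "pos p" "pos q" "q * b = 1 + p" by blast
  define r where "r = max 1 (norm q)"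
  have r: "r > 0" by (simp add: r_def)
  have step: "pos (b + (s - 1 / r) *\<^sub>R 1)" if "pos (b + s *\<^sub>R 1)" "s \<ge> 0" for s
  proof -
    have "pos ((r *\<^sub>R 1 - q) * (b + s *\<^sub>R 1))"
      using pos_norm_diff(1)[of q r] star_H[OF pq(2)]
      by (intro pos_mult_H that H_intros pq b) (auto simp: r_def)
    then have "pos ((1 / r) *\<^sub>R ((r *\<^sub>R 1 - q) * (b + s *\<^sub>R 1) + p + s *\<^sub>R q))"
      using r that by (intro pos_scaleR pos_add pq) auto
    also have "(r *\<^sub>R 1 - q) * (b + s *\<^sub>R 1) + p + s *\<^sub>R q = r *\<^sub>R b + (r * s) *\<^sub>R 1 - 1"
      using pq(5) by (simp add: algebra_simps)
    also have "(1 / r) *\<^sub>R \<dots> = b + (s - 1 / r) *\<^sub>R 1" using r by (simp add: algebra_simps)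
    finally show ?thesis .
  qed
  have it: "pos (b + max 0 (norm b - real n / r) *\<^sub>R 1)" for n
  proof (induction n)
    case 0
    then show ?case using pos_norm_diff(2)[OF star_H[OF b] order_refl] by (simp add: add.commute)
  next
    case (Suc n)
    define s where "s = max 0 (norm b - real n / r)"
    define s' where "s' = max 0 (norm b - real (Suc n) / r)"
    have "real (Suc n) / r = real n / r + 1 / r" "1 / r > 0"
      using r by (simp_all add: add_divide_distrib)
    then have "s - 1 / r \<le> s'" unfolding s_def s'_def by linarith
    then have "pos ((b + (s - 1 / r) *\<^sub>R 1) + (s' - (s - 1 / r)) *\<^sub>R 1)"
      by (intro pos_add[OF step pos_const]) (use Suc in \<open>simp_all add: s_def\<close>)
    then show ?case by (simp add: algebra_simps s'_def)
  qed
  obtain n where "norm b * r < real n" using reals_Archimedean2 by blast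
  then have "norm b - real n / r \<le> 0" using r by (simp add: field_simps)
  then have "pos (b + 0 *\<^sub>R 1)" using it[of n] by (simp add: max_absorb1)
  from step[OF this] have "pos (b - (1 / r) *\<^sub>R 1)" by simp
  then show ?thesis using r by (intro exI[of _ "1 / r"]) simp
qed

lemma pos_of_characters:
  assumes b: "b \<in> H" and om: "\<And>\<omega>. real_character \<omega> \<Longrightarrow> \<omega> b \<ge> 0"
  shows "pos b"
proof (rule pos_epsilon)
  fix e :: real assume e: "e > 0"
  have "\<omega> (b + e *\<^sub>R 1) > 0" if "real_character \<omega>" for \<omega>
  proof -
    have "\<omega> (b + e *\<^sub>R 1) = \<omega> b + e"
      using that b by (simp add: real_character_def scaleR_H)
    then show ?thesis using om[OF that] e by simp
  qed
  then obtain d where d: "d > 0" "pos (b + e *\<^sub>R 1 - d *\<^sub>R 1)"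
    using pos_of_characters_strict[of "b + e *\<^sub>R 1"] b by (auto intro: H_intros)
  then have "pos ((b + e *\<^sub>R 1 - d *\<^sub>R 1) + d *\<^sub>R 1)"
    by (intro pos_add pos_const) auto
  then show "pos (b + e *\<^sub>R 1)" by simp
qed

end

section \<open>Generated subalgebras\<close>

lemma cstar_subalgebraD:
  assumes "cstar_subalgebra S"
  shows "0 \<in> S" "x \<in> S \<Longrightarrow> y \<in> S \<Longrightarrow> x + y \<in> S" "x \<in> S \<Longrightarrow> y \<in> S \<Longrightarrow> x * y \<in> S"
    "x \<in> S \<Longrightarrow> c *\<^sub>C x \<in> S" "x \<in> S \<Longrightarrow> star x \<in> S" "closed S"
    "x \<in> S \<Longrightarrow> r *\<^sub>R x \<in> S" "x \<in> S \<Longrightarrow> - x \<in> S" "x \<in> S \<Longrightarrow> y \<in> S \<Longrightarrow> x - y \<in> S"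
    "subspace S"
proof -
  note S = assms[unfolded cstar_subalgebra_def]
  show 1: "0 \<in> S" "x \<in> S \<Longrightarrow> y \<in> S \<Longrightarrow> x + y \<in> S" "x \<in> S \<Longrightarrow> y \<in> S \<Longrightarrow> x * y \<in> S"
    "x \<in> S \<Longrightarrow> c *\<^sub>C x \<in> S" "x \<in> S \<Longrightarrow> star x \<in> S" "closed S" for x y c
    using S by auto
  show 2: "x \<in> S \<Longrightarrow> r *\<^sub>R x \<in> S" for x r using S by (metis scaleC_of_real)
  show "subspace S" using 1 2 by (auto simp: subspace_def)
  then show "x \<in> S \<Longrightarrow> - x \<in> S" "x \<in> S \<Longrightarrow> y \<in> S \<Longrightarrow> x - y \<in> S"
    by (auto intro: subspace_neg subspace_diff)
qed

lemma cstar_subalgebraI: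
  assumes "0 \<in> S" "\<And>x y. x \<in> S \<Longrightarrow> y \<in> S \<Longrightarrow> x + y \<in> S" "\<And>x y. x \<in> S \<Longrightarrow> y \<in> S \<Longrightarrow> x * y \<in> S"
    "\<And>x c. x \<in> S \<Longrightarrow> c *\<^sub>C x \<in> S" "\<And>x. x \<in> S \<Longrightarrow> star x \<in> S" "closed S"
  shows "cstar_subalgebra S"
  using assms by (auto simp: cstar_subalgebra_def)

lemma
  fixes a :: "'n \<Rightarrow> 'a::cstar_algebra"
  shows cstar_generated_subalgebra: "cstar_subalgebra (cstar_generated a)"
  and one_cstar_generated [simp]: "1 \<in> cstar_generated a"
  and mem_cstar_generated [simp]: "a i \<in> cstar_generated a"
proof -
  have "(\<lambda>S. cstar_subalgebra S \<and> 1 \<in> S) (cstar_generated a)"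
    unfolding cstar_generated_def
  proof (rule hull_in)
    fix T :: "'a set set" assume T: "\<forall>S\<in>T. cstar_subalgebra S \<and> 1 \<in> S"
    show "cstar_subalgebra (\<Inter>T) \<and> 1 \<in> \<Inter>T"
    proof
      show "cstar_subalgebra (\<Inter>T)"
      proof (rule cstar_subalgebraI)
        show "closed (\<Inter>T)" by (rule closed_Inter) (use T cstar_subalgebraD(6) in blast)
        show "star x \<in> \<Inter>T" if "x \<in> \<Inter>T" for x
          using T that cstar_subalgebraD(5) by blast
        show "c *\<^sub>C x \<in> \<Inter>T" if "x \<in> \<Inter>T" for c x
          using T that cstar_subalgebraD(4) by blast
        show "x + y \<in> \<Inter>T" if "x \<in> \<Inter>T" "y \<in> \<Inter>T" for x y
          using T that cstar_subalgebraD(2) by blast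
        show "x * y \<in> \<Inter>T" if "x \<in> \<Inter>T" "y \<in> \<Inter>T" for x y
          using T that cstar_subalgebraD(3) by blast
        show "0 \<in> \<Inter>T" using T cstar_subalgebraD(1) by blast
      qed
    qed (use T in auto)
  qed
  then show "cstar_subalgebra (cstar_generated a)" "1 \<in> cstar_generated a" by auto
  show "a i \<in> cstar_generated a"
    unfolding cstar_generated_def using hull_subset by (metis rangeI subsetD)
qed

lemma cstar_generated_minimal:
  assumes "cstar_subalgebra T" "1 \<in> T" "\<And>i. a i \<in> T"
  shows "cstar_generated a \<subseteq> T"
  unfolding cstar_generated_def by (rule hull_minimal) (use assms in auto)

lemma commutant_subalgebra:
  fixes T :: "'a::cstar_algebra set"
  assumes "\<And>y. y \<in> T \<Longrightarrow> star y \<in> T"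
  shows "cstar_subalgebra {x. \<forall>y\<in>T. x * y = y * x}"
proof (rule cstar_subalgebraI)
  show "closed {x::'a. \<forall>y\<in>T. x * y = y * x}"
    unfolding Ball_def by (intro closed_Collect_all closed_Collect_imp closed_Collect_eq continuous_intros) auto
  fix x :: 'a assume "x \<in> {x. \<forall>y\<in>T. x * y = y * x}"
  then have x: "x * y = y * x" if "y \<in> T" for y using that by simp
  have "star x * y = y * star x" if "y \<in> T" for y
    using arg_cong[OF x[OF assms[OF that]], of star] by (simp add: star_mult star_star)
  then show "star x \<in> {x. \<forall>y\<in>T. x * y = y * x}" by simp
  fix z :: 'a assume "z \<in> {x. \<forall>y\<in>T. x * y = y * x}"
  then have z: "z * y = y * z" if "y \<in> T" for y using that by simp
  have "x * z * y = y * (x * z)" if "y \<in> T" for y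
    by (metis mult.assoc that x z)
  then show "x * z \<in> {x. \<forall>y\<in>T. x * y = y * x}" by simp
qed (auto simp: algebra_simps mult_scaleC_left mult_scaleC_right)

section \<open>Commuting self-adjoint families\<close>

lemma re_part_eq: "star u = u \<Longrightarrow> star v = v \<Longrightarrow> re_part (u + \<i> *\<^sub>C v) = (u::'a::cstar_algebra)"
  by (simp add: re_part_def star_add star_scaleC scaleC_minus_left flip: scaleR_2)

lemma im_part_eq: "star u = u \<Longrightarrow> star v = v \<Longrightarrow> im_part (u + \<i> *\<^sub>C v) = (v::'a::cstar_algebra)"
  by (simp add: im_part_def star_add star_scaleC scaleC_minus_left scaleC_diff_right scaleC_minus_right
      flip: scaleR_2)

text \<open>A finite tuple of mutually commuting self-adjoint elements, with the unital \<open>C\<^sup>*\<close>-algebra \<open>S\<close> that it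
  generates and the self-adjoint part \<open>H\<close> of \<open>S\<close>.\<close>

locale commuting_family =
  fixes a :: "'n::finite \<Rightarrow> 'a::cstar_algebra"
  assumes star_a: "\<And>i. star (a i) = a i" and comm_a: "\<And>i j. a i * a j = a j * a i"
begin

abbreviation S :: "'a set" where "S \<equiv> cstar_generated a"

definition H :: "'a set" where "H = {x \<in> S. star x = x}"

lemmas S_intros = cstar_subalgebraD(1-5,7-9)[OF cstar_generated_subalgebra[of a]]
  one_cstar_generated mem_cstar_generated

lemma closed_S: "closed S"
  by (rule cstar_subalgebraD(6)[OF cstar_generated_subalgebra])

lemma comm_S: "x \<in> S \<Longrightarrow> y \<in> S \<Longrightarrow> x * y = y * x"
proof -
  have 1: "S \<subseteq> {x. \<forall>y\<in>range a. x * y = y * x}"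
    by (rule cstar_generated_minimal[OF commutant_subalgebra]) (use star_a comm_a in auto)
  have "S \<subseteq> {x. \<forall>y\<in>S. x * y = y * x}"
    by (rule cstar_generated_minimal[OF commutant_subalgebra]) (use 1 in \<open>auto intro: S_intros\<close>)
  then show "x \<in> S \<Longrightarrow> y \<in> S \<Longrightarrow> x * y = y * x" by blast
qed

sublocale sa_comm_algebra H
proof
  show "closed H"
    unfolding H_def by (intro closed_Collect_conj closed_Collect_eq continuous_intros)
      (simp add: closed_S)
  show "subspace H" by (auto simp: H_def subspace_def star_add intro: S_intros)
qed (auto simp: H_def star_mult comm_S intro: S_intros)

lemma H_S: "x \<in> H \<Longrightarrow> x \<in> S" and a_H [simp]: "a i \<in> H"
  by (auto simp: H_def star_a)

lemma re_part_H: "x \<in> S \<Longrightarrow> re_part x \<in> H" and im_part_H: "x \<in> S \<Longrightarrow> im_part x \<in> H"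
  by (simp_all add: H_def) (simp_all add: re_part_def im_part_def S_intros)

abbreviation character :: "('a \<Rightarrow> complex) \<Rightarrow> bool" where "character \<equiv> is_character S"

context
  fixes \<gamma> assumes \<gamma>: "character \<gamma>"
begin

lemma char_add: "x \<in> S \<Longrightarrow> y \<in> S \<Longrightarrow> \<gamma> (x + y) = \<gamma> x + \<gamma> y"
  and char_mult: "x \<in> S \<Longrightarrow> y \<in> S \<Longrightarrow> \<gamma> (x * y) = \<gamma> x * \<gamma> y"
  and char_scaleC: "x \<in> S \<Longrightarrow> \<gamma> (c *\<^sub>C x) = c * \<gamma> x"
  using \<gamma> by (auto simp: is_character_def)

lemma char_scaleR: "x \<in> S \<Longrightarrow> \<gamma> (r *\<^sub>R x) = of_real r * \<gamma> x"
  using char_scaleC[of x "complex_of_real r"] by (simp add: scaleC_of_real)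

lemma char_minus: "x \<in> S \<Longrightarrow> \<gamma> (- x) = - \<gamma> x"
  using char_scaleC[of x "-1"] by (simp add: scaleC_minus_one)

lemma char_diff: "x \<in> S \<Longrightarrow> y \<in> S \<Longrightarrow> \<gamma> (x - y) = \<gamma> x - \<gamma> y"
  using char_add[of x "- y"] char_minus[of y] by (simp add: S_intros)

lemma char_one: "\<gamma> 1 = 1"
proof -
  obtain x where x: "x \<in> S" "\<gamma> x \<noteq> 0" using \<gamma> by (auto simp: is_character_def)
  have "\<gamma> 1 * \<gamma> x = \<gamma> x" using char_mult[of 1 x] x by simp
  then show ?thesis using x by simp
qed

lemma char_zero: "\<gamma> 0 = 0"
  using char_scaleC[of 1 0] by simp

lemma char_sum: "(\<And>i. i \<in> A \<Longrightarrow> f i \<in> S) \<Longrightarrow> \<gamma> (sum f A) = (\<Sum>i\<in>A. \<gamma> (f i)) \<and> sum f A \<in> S"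
proof (induction A rule: infinite_finite_induct)
  case (insert x F)
  then have "f x \<in> S" "\<gamma> (sum f F) = (\<Sum>i\<in>F. \<gamma> (f i))" "sum f F \<in> S" by auto
  then show ?case using insert(1,2) char_add[of "f x" "sum f F"] by (simp add: S_intros)
qed (simp_all add: char_zero S_intros)

text \<open>Characters are contractive: if \<open>\<gamma>(w) = 1\<close> and \<open>\<parallel>w\<parallel> < 1\<close>, then the geometric series \<open>z = 1 + w z\<close> lies in
  \<open>S\<close>, and applying \<open>\<gamma>\<close> gives \<open>\<gamma>(z) = 1 + \<gamma>(z)\<close>.\<close>

lemma char_norm:
  assumes x: "x \<in> S" shows "cmod (\<gamma> x) \<le> norm x"
proof (rule ccontr)
  assume n: "\<not> ?thesis"
  then have g: "\<gamma> x \<noteq> 0" by auto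
  define w where "w = (1 / \<gamma> x) *\<^sub>C x"
  have wS: "w \<in> S" by (simp add: w_def x S_intros)
  have gw: "\<gamma> w = 1" using g by (simp add: w_def char_scaleC x)
  have "norm w < 1" using n g by (simp add: w_def norm_scaleC norm_divide divide_less_eq)
  then have s: "summable (\<lambda>n. w ^ n)" by (rule complete_algebra_summable_geometric)
  have pw: "w ^ n \<in> S" for n by (induction n) (auto intro: S_intros wS)
  have inS: "(\<Sum>n. w ^ n) \<in> S"
  proof (rule closed_sequentially[OF closed_S])
    show "(\<lambda>n. \<Sum>i<n. w ^ i) \<longlonglongrightarrow> (\<Sum>n. w ^ n)" by (rule summable_LIMSEQ[OF s])
    show "(\<Sum>i<n. w ^ i) \<in> S" for n using char_sum[of "{..<n}" "\<lambda>i. w ^ i"] pw by blast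
  qed
  have "(\<Sum>n. w ^ n) = w ^ 0 + (\<Sum>n. w ^ Suc n)"
    using suminf_split_head[OF s] by simp
  also have "(\<Sum>n. w ^ Suc n) = w * (\<Sum>n. w ^ n)" by (simp add: suminf_mult[OF s])
  finally have "\<gamma> (\<Sum>n. w ^ n) = \<gamma> (1 + w * (\<Sum>n. w ^ n))" by simp
  also have "\<dots> = 1 + \<gamma> (\<Sum>n. w ^ n)"
    by (simp add: char_add char_mult S_intros wS inS char_one gw)
  finally show False by simp
qed

text \<open>Arens' argument: contractivity on \<open>x + \<i> s\<close> for all real \<open>s\<close> forces \<open>\<gamma>(x)\<close> to be real.\<close>

lemma char_real:
  assumes x: "x \<in> H" shows "Im (\<gamma> x) = 0"
proof (rule ccontr)
  assume b: "Im (\<gamma> x) \<noteq> 0"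
  have xS: "x \<in> S" using x by (rule H_S)
  have bound: "(Im (\<gamma> x) + s)\<^sup>2 \<le> norm x * norm x + s\<^sup>2" for s
  proof -
    define y where "y = x + (\<i> * complex_of_real s) *\<^sub>C 1"
    have yS: "y \<in> S" by (simp add: y_def xS S_intros)
    have "\<gamma> y = \<gamma> x + \<i> * complex_of_real s"
      by (simp add: y_def char_add char_scaleC char_one xS S_intros)
    then have "(Im (\<gamma> x) + s)\<^sup>2 \<le> (cmod (\<gamma> y))\<^sup>2" by (simp add: cmod_power2)
    also have "\<dots> \<le> (norm y)\<^sup>2" using char_norm[OF yS] by (intro power_mono) auto
    also have "\<dots> = norm (star y * y)" by (simp add: cstar_identity)
    also have "star y * y = x * x + (s * s) *\<^sub>R 1"
    proof -
      have y: "y = x + s *\<^sub>R (\<i> *\<^sub>C 1)"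
        by (simp add: y_def flip: scaleC_of_real) (simp add: scaleC_scaleC mult.commute)
      show ?thesis
        unfolding y using star_H[OF x]
        by (simp add: scaleC_scaleR star_add star_scaleC scaleC_minus_left algebra_simps scaleC_diff_right
            mult_scaleC_left mult_scaleC_right)
    qed
    also have "norm \<dots> \<le> norm (x * x) + norm ((s * s) *\<^sub>R (1::'a))" by (rule norm_triangle_ineq)
    also have "\<dots> \<le> norm x * norm x + s\<^sup>2"
      by (simp add: norm_mult_ineq power2_eq_square)
    finally show ?thesis .
  qed
  define \<beta> where "\<beta> = Im (\<gamma> x)"
  have "(\<beta> + s)\<^sup>2 = \<beta>\<^sup>2 + 2 * \<beta> * s + s\<^sup>2" for s by (simp add: power2_eq_square algebra_simps)
  then have "\<beta>\<^sup>2 + 2 * \<beta> * s \<le> norm x * norm x" for s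
    using bound[of s] by (simp add: \<beta>_def)
  from this[of "(norm x * norm x) / (2 * \<beta>)"] show False using b by (simp add: \<beta>_def)
qed

lemma char_H: "x \<in> H \<Longrightarrow> \<gamma> x = complex_of_real (Re (\<gamma> x))"
  by (simp add: char_real complex_eq_iff)

lemma char_decompose: "x \<in> S \<Longrightarrow> \<gamma> x = \<gamma> (re_part x) + \<i> * \<gamma> (im_part x)"
  using char_add[of "re_part x" "\<i> *\<^sub>C im_part x"] char_scaleC[of "im_part x" \<i>]
  by (simp add: H_S S_intros re_part_H im_part_H flip: re_im_decompose)

lemma char_star:
  assumes "x \<in> S" shows "\<gamma> (star x) = cnj (\<gamma> x)"
proof -
  have "star x = re_part x - \<i> *\<^sub>C im_part x"
    by (subst re_im_decompose[of x]) (simp add: star_add star_scaleC scaleC_minus_left)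
  then have "\<gamma> (star x) = \<gamma> (re_part x) - \<i> * \<gamma> (im_part x)"
    using assms by (simp add: char_diff char_scaleC H_S re_part_H im_part_H S_intros)
  also have "\<dots> = cnj (\<gamma> (re_part x) + \<i> * \<gamma> (im_part x))"
    using char_real[OF re_part_H[OF assms]] char_real[OF im_part_H[OF assms]]
    by (simp add: complex_eq_iff)
  finally show ?thesis using char_decompose[OF assms] by simp
qed

lemma char_pos:
  assumes "x \<in> H" "pos x" shows "Re (\<gamma> x) \<ge> 0"
proof -
  obtain v where v: "v * v = x" "pos v"
    "\<And>T. \<lbrakk>closed T; subspace T; \<And>z. z \<in> T \<Longrightarrow> z * z \<in> T; x \<in> T\<rbrakk> \<Longrightarrow> v \<in> T"
    using pos_sqrt[OF assms(2)] by blast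
  have "v \<in> H" by (rule v(3)) (use closed_H subspace_H mult_H assms in auto)
  then show ?thesis using char_mult[of v v] char_real[of v] by (simp add: v(1) H_S)
qed

end

lemma character_extend:
  assumes \<omega>: "real_character \<omega>"
  shows "\<exists>\<gamma>. character \<gamma> \<and> (\<forall>x\<in>H. \<gamma> x = complex_of_real (\<omega> x))"
proof (intro exI conjI ballI)
  define \<gamma> where "\<gamma> x = Complex (\<omega> (re_part x)) (\<omega> (im_part x))" for x
  note w = \<omega>[unfolded real_character_def]
  have eq: "\<gamma> (u + \<i> *\<^sub>C v) = Complex (\<omega> u) (\<omega> v)" if "u \<in> H" "v \<in> H" for u v
    using that by (simp add: \<gamma>_def re_part_eq im_part_eq star_H)
  have w0: "\<omega> 0 = 0" using w one_H by (metis mult_zero_left scaleR_zero_left)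
  have wm: "\<omega> (x - y) = \<omega> x - \<omega> y" if "x \<in> H" "y \<in> H" for x y
    using w that by (metis H_intros(2) add_diff_cancel_right' diff_add_cancel)
  show "character \<gamma>"
    unfolding is_character_def
  proof (intro conjI ballI allI)
    show "\<exists>x\<in>S. \<gamma> x \<noteq> 0"
      using w eq[of 1 0] w0 by (intro bexI[of _ 1]) (auto simp: complex_eq_iff)
    fix x assume x: "x \<in> S"
    define u v where "u = re_part x" and "v = im_part x"
    have xuv: "x = u + \<i> *\<^sub>C v" unfolding u_def v_def by (rule re_im_decompose)
    have uv: "u \<in> H" "v \<in> H" using x by (auto simp: u_def v_def re_part_H im_part_H)
    show "\<gamma> (c *\<^sub>C x) = c * \<gamma> x" for c
    proof -
      have "c *\<^sub>C x = (Re c *\<^sub>R u - Im c *\<^sub>R v) + \<i> *\<^sub>C (Im c *\<^sub>R u + Re c *\<^sub>R v)"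
        unfolding xuv by (subst scaleC_decompose)
          (simp add: algebra_simps scaleC_add_right scaleC_diff_right scaleC_scaleR)
      then have "\<gamma> (c *\<^sub>C x) = Complex (\<omega> (Re c *\<^sub>R u - Im c *\<^sub>R v)) (\<omega> (Im c *\<^sub>R u + Re c *\<^sub>R v))"
        by (simp only:) (intro eq H_intros uv)
      then show ?thesis
        using w uv by (simp add: xuv eq wm H_intros complex_eq_iff)
    qed
    fix y assume y: "y \<in> S"
    define p q where "p = re_part y" and "q = im_part y"
    have ypq: "y = p + \<i> *\<^sub>C q" unfolding p_def q_def by (rule re_im_decompose)
    have pq: "p \<in> H" "q \<in> H" using y by (auto simp: p_def q_def re_part_H im_part_H)
    have "x + y = (u + p) + \<i> *\<^sub>C (v + q)" by (simp add: xuv ypq scaleC_add_right)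
    then have "\<gamma> (x + y) = Complex (\<omega> (u + p)) (\<omega> (v + q))"
      by (simp only:) (intro eq H_intros uv pq)
    then show "\<gamma> (x + y) = \<gamma> x + \<gamma> y"
      using w uv pq by (simp add: xuv ypq eq complex_eq_iff)
    have "x * y = (u * p - v * q) + \<i> *\<^sub>C (u * q + v * p)"
      by (simp add: xuv ypq algebra_simps scaleC_add_right mult_scaleC_left mult_scaleC_right)
    then have "\<gamma> (x * y) = Complex (\<omega> (u * p - v * q)) (\<omega> (u * q + v * p))"
      by (simp only:) (intro eq H_intros uv pq)
    then show "\<gamma> (x * y) = \<gamma> x * \<gamma> y"
      using w uv pq by (simp add: xuv ypq eq complex_eq_iff wm H_intros)
  qed
  show "\<gamma> x = complex_of_real (\<omega> x)" if "x \<in> H" for x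
    using eq[of x 0] that w0 by (simp add: complex_eq_iff)
qed

lemma pos_of_chars:
  assumes "x \<in> H" "\<And>\<gamma>. character \<gamma> \<Longrightarrow> Re (\<gamma> x) \<ge> 0" shows "pos x"
proof (rule pos_of_characters[OF assms(1)])
  fix \<omega> assume "real_character \<omega>"
  then obtain \<gamma> where "character \<gamma>" "\<gamma> x = complex_of_real (\<omega> x)"
    using character_extend assms(1) by blast
  then show "\<omega> x \<ge> 0" using assms(2)[of \<gamma>] by simp
qed

lemma pos_of_chars_strict:
  assumes "x \<in> H" "\<And>\<gamma>. character \<gamma> \<Longrightarrow> Re (\<gamma> x) > 0" shows "\<exists>\<delta>>0. pos (x - \<delta> *\<^sub>R 1)"
proof (rule pos_of_characters_strict[OF assms(1)])
  fix \<omega> assume "real_character \<omega>"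
  then obtain \<gamma> where "character \<gamma>" "\<gamma> x = complex_of_real (\<omega> x)"
    using character_extend assms(1) by blast
  then show "\<omega> x > 0" using assms(2)[of \<gamma>] by simp
qed

lemma norm_le_of_chars:
  assumes "x \<in> H" "\<And>\<gamma>. character \<gamma> \<Longrightarrow> \<bar>Re (\<gamma> x)\<bar> \<le> r" "r \<ge> 0" shows "norm x \<le> r"
proof (rule norm_le_of_pos[OF _ _ assms(3)])
  have v: "Re (\<gamma> (r *\<^sub>R 1 - x)) = r - Re (\<gamma> x)" "Re (\<gamma> (r *\<^sub>R 1 + x)) = r + Re (\<gamma> x)"
    if "character \<gamma>" for \<gamma>
    using assms(1)
    by (simp_all add: char_add[OF that] char_diff[OF that] char_scaleR[OF that] char_one[OF that]
        H_S S_intros)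
  show "pos (r *\<^sub>R 1 - x)"
    by (rule pos_of_chars) (use assms(1,2) in \<open>auto intro: H_intros simp: v abs_le_iff\<close>)
  show "pos (r *\<^sub>R 1 + x)"
  proof (rule pos_of_chars)
    show "Re (\<gamma> (r *\<^sub>R 1 + x)) \<ge> 0" if "character \<gamma>" for \<gamma>
      using assms(2)[OF that] by (simp add: v[OF that])
  qed (use assms(1) in \<open>auto intro: H_intros\<close>)
qed

lemma eq_of_chars:
  assumes "x \<in> S" "y \<in> S" "\<And>\<gamma>. character \<gamma> \<Longrightarrow> \<gamma> x = \<gamma> y" shows "x = y"
proof -
  define z where "z = x - y"
  have z: "z \<in> S" by (simp add: z_def assms(1,2) S_intros)
  have gz: "\<gamma> z = 0" if "character \<gamma>" for \<gamma>
    using assms(3)[OF that] by (simp add: z_def char_diff[OF that] assms(1,2))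
  have "Re (\<gamma> (re_part z)) = 0 \<and> Re (\<gamma> (im_part z)) = 0" if "character \<gamma>" for \<gamma>
    using char_decompose[OF that z] gz[OF that] char_real[OF that re_part_H[OF z]]
      char_real[OF that im_part_H[OF z]] by (auto simp: complex_eq_iff)
  note h = this
  have "norm (re_part z) \<le> 0" by (rule norm_le_of_chars[OF re_part_H[OF z]]) (use h in simp_all)
  moreover have "norm (im_part z) \<le> 0"
    by (rule norm_le_of_chars[OF im_part_H[OF z]]) (use h in simp_all)
  ultimately have "re_part z = 0" "im_part z = 0" by simp_all
  then have "z = 0" using re_im_decompose[of z] by simp
  then show ?thesis by (simp add: z_def)
qed

end

section \<open>Gelfand transform and functional calculus\<close>

context commuting_family
begin

text \<open>The point of the joint spectrum given by a character.\<close>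

definition pt :: "('a \<Rightarrow> complex) \<Rightarrow> real ^ 'n" where
  "pt \<gamma> = vec_lambda (\<lambda>i. Re (\<gamma> (a i)))"

abbreviation K :: "(real ^ 'n) set" where "K \<equiv> joint_spectrum a"

lemma char_a: "character \<gamma> \<Longrightarrow> \<gamma> (a i) = complex_of_real (pt \<gamma> $ i)"
  by (simp add: pt_def char_H[OF _ a_H, symmetric])

lemma pt_K: "character \<gamma> \<Longrightarrow> pt \<gamma> \<in> K"
  unfolding joint_spectrum_def using char_a by blast

lemma K_pt:
  assumes "t \<in> K" obtains \<gamma> where "character \<gamma>" "pt \<gamma> = t"
proof -
  obtain \<gamma> where g: "character \<gamma>" "\<And>i. \<gamma> (a i) = complex_of_real (t $ i)"
    using assms by (auto simp: joint_spectrum_def)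
  then have "pt \<gamma> = t" by (simp add: pt_def vec_eq_iff)
  then show ?thesis using that g by blast
qed

lemma char_tendsto:
  assumes g: "character \<gamma>" and u: "\<And>n. u n \<in> S" "u \<longlonglongrightarrow> l"
  shows "(\<lambda>n. \<gamma> (u n)) \<longlonglongrightarrow> \<gamma> l"
proof (rule metric_LIMSEQ_I)
  have lS: "l \<in> S" using closed_sequentially[OF closed_S u] .
  fix r :: real assume "r > 0"
  then obtain N where N: "\<And>n. n \<ge> N \<Longrightarrow> dist (u n) l < r"
    using metric_LIMSEQ_D[OF u(2)] by blast
  have "dist (\<gamma> (u n)) (\<gamma> l) \<le> dist (u n) l" for n
    using char_norm[OF g, of "u n - l"] u(1) lS by (simp add: dist_norm char_diff[OF g] S_intros)
  then show "\<exists>no. \<forall>n\<ge>no. dist (\<gamma> (u n)) (\<gamma> l) < r" using N le_less_trans by blast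
qed

text \<open>A character is determined by its point.\<close>

lemma char_unique:
  assumes g: "character \<gamma>" and d: "character \<delta>" and "pt \<gamma> = pt \<delta>" and x: "x \<in> S"
  shows "\<gamma> x = \<delta> x"
proof -
  have "S \<subseteq> {x \<in> S. \<gamma> x = \<delta> x}"
  proof (rule cstar_generated_minimal)
    show "cstar_subalgebra {x \<in> S. \<gamma> x = \<delta> x}"
    proof (rule cstar_subalgebraI)
      show "closed {x \<in> S. \<gamma> x = \<delta> x}"
        unfolding closed_sequential_limits
      proof (intro allI impI)
        fix u l assume *: "(\<forall>n. u n \<in> {x \<in> S. \<gamma> x = \<delta> x}) \<and> u \<longlonglongrightarrow> l"
        then have uS: "u n \<in> S" and ud: "\<gamma> (u n) = \<delta> (u n)" and ul: "u \<longlonglongrightarrow> l" for n by auto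
        have lS: "l \<in> S" using closed_sequentially[OF closed_S uS ul] .
        have lim: "(\<lambda>n. \<epsilon> (u n)) \<longlonglongrightarrow> \<epsilon> l" if "character \<epsilon>" for \<epsilon>
          by (rule char_tendsto[OF that uS ul])
        have "(\<lambda>n. \<delta> (u n)) \<longlonglongrightarrow> \<gamma> l" using lim[OF g] by (simp add: ud)
        then have "\<gamma> l = \<delta> l" using lim[OF d] LIMSEQ_unique by blast
        then show "l \<in> {x \<in> S. \<gamma> x = \<delta> x}" using lS by simp
      qed
    qed (auto simp: char_zero[OF g] char_zero[OF d] char_add[OF g] char_add[OF d] char_mult[OF g]
        char_mult[OF d] char_scaleC[OF g] char_scaleC[OF d] char_star[OF g] char_star[OF d]
        S_intros(1-5))
    show "1 \<in> {x \<in> S. \<gamma> x = \<delta> x}" by (simp add: char_one[OF g] char_one[OF d])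
    show "a i \<in> {x \<in> S. \<gamma> x = \<delta> x}" for i
      using char_a[OF g] char_a[OF d] assms(3) by simp
  qed
  then show ?thesis using x by blast
qed

text \<open>The character at a given point of the joint spectrum. Then \<open>\<lambda>t. char_at t x\<close> is the Gelfand transform of
  \<open>x\<close> as a function on the joint spectrum; outside the joint spectrum \<open>char_at\<close> is arbitrary.\<close>

definition char_at :: "real ^ 'n \<Rightarrow> 'a \<Rightarrow> complex" where
  "char_at t = (SOME \<gamma>. character \<gamma> \<and> pt \<gamma> = t)"

lemma char_at: assumes "t \<in> K" shows "character (char_at t)" "pt (char_at t) = t"
proof -
  have "\<exists>\<gamma>. character \<gamma> \<and> pt \<gamma> = t" using K_pt[OF assms] by blast
  then have "character (char_at t) \<and> pt (char_at t) = t" unfolding char_at_def by (rule someI_ex)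
  then show "character (char_at t)" "pt (char_at t) = t" by auto
qed

lemma gelfand_continuous:
  assumes "x \<in> S"
  shows "continuous_on K (\<lambda>t. char_at t x)"
proof -
  note c = char_at(1)
  let ?T = "{x \<in> S. continuous_on K (\<lambda>t. char_at t x)}"
  have "S \<subseteq> ?T"
  proof (rule cstar_generated_minimal)
    show "cstar_subalgebra ?T"
    proof (rule cstar_subalgebraI)
      show "closed ?T"
        unfolding closed_sequential_limits
      proof (intro allI impI)
        fix u l assume *: "(\<forall>n. u n \<in> ?T) \<and> u \<longlonglongrightarrow> l"
        then have uS: "u n \<in> S" and uc: "continuous_on K (\<lambda>t. char_at t (u n))"
          and ul: "u \<longlonglongrightarrow> l" for n by auto
        have lS: "l \<in> S" using closed_sequentially[OF closed_S uS ul] .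
        have "uniform_limit K (\<lambda>n t. char_at t (u n)) (\<lambda>t. char_at t l) sequentially"
        proof (rule uniform_limitI)
          fix r :: real assume "r > 0"
          then have ev: "\<forall>\<^sub>F n in sequentially. dist (u n) l < r" using ul by (simp add: tendsto_iff)
          have le: "dist (char_at t (u n)) (char_at t l) \<le> dist (u n) l" if "t \<in> K" for t n
            using char_norm[OF c[OF that], of "u n - l"] uS lS
            by (simp add: dist_norm char_diff[OF c[OF that]] S_intros)
          show "\<forall>\<^sub>F n in sequentially. \<forall>t\<in>K. dist (char_at t (u n)) (char_at t l) < r"
            by (rule eventually_mono[OF ev]) (use le le_less_trans in blast)
        qed
        then have "continuous_on K (\<lambda>t. char_at t l)"
          by (rule uniform_limit_theorem[rotated]) (auto intro: always_eventually uc)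
        then show "l \<in> ?T" using lS by simp
      qed
      show "0 \<in> ?T"
        using continuous_on_cong[OF refl, of K "\<lambda>t. char_at t 0" "\<lambda>t. 0"]
        by (simp add: char_zero[OF c] S_intros(1))
      fix x assume x: "x \<in> ?T"
      then have xS: "x \<in> S" and xc: "continuous_on K (\<lambda>t. char_at t x)" by auto
      show "k *\<^sub>C x \<in> ?T" for k
        using continuous_on_cong[OF refl, of K "\<lambda>t. char_at t (k *\<^sub>C x)" "\<lambda>t. k * char_at t x"]
        by (simp add: xS char_scaleC[OF c] S_intros(4) continuous_on_mult_left xc)
      show "star x \<in> ?T"
        using continuous_on_cong[OF refl, of K "\<lambda>t. char_at t (star x)" "\<lambda>t. cnj (char_at t x)"]
        by (simp add: xS char_star[OF c] S_intros(5) continuous_on_cnj xc)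
      fix y assume y: "y \<in> ?T"
      then have yS: "y \<in> S" and yc: "continuous_on K (\<lambda>t. char_at t y)" by auto
      show "x + y \<in> ?T"
        using continuous_on_cong[OF refl, of K "\<lambda>t. char_at t (x + y)" "\<lambda>t. char_at t x + char_at t y"]
        by (simp add: xS yS char_add[OF c] S_intros(2) continuous_on_add xc yc)
      show "x * y \<in> ?T"
        using continuous_on_cong[OF refl, of K "\<lambda>t. char_at t (x * y)" "\<lambda>t. char_at t x * char_at t y"]
        by (simp add: xS yS char_mult[OF c] S_intros(3) continuous_on_mult xc yc)
    qed
    show "1 \<in> ?T"
      using continuous_on_cong[OF refl, of K "\<lambda>t. char_at t 1" "\<lambda>t. 1"] by (simp add: char_one[OF c])
    show "a i \<in> ?T" for i
      using continuous_on_cong[OF refl, of K "\<lambda>t. char_at t (a i)" "\<lambda>t. complex_of_real (t $ i)"]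
      by (simp add: char_a[OF c] char_at(2) continuous_intros)
  qed
  then show ?thesis using assms by blast
qed

lemma char_eq_char_at: "character \<gamma> \<Longrightarrow> x \<in> S \<Longrightarrow> \<gamma> x = char_at (pt \<gamma>) x"
  using char_at[OF pt_K] by (intro char_unique) auto

text \<open>The element whose Gelfand transform is the squared distance to \<open>t\<close>.\<close>

definition dist_sq :: "real ^ 'n \<Rightarrow> 'a" where
  "dist_sq t = (\<Sum>i\<in>UNIV. (a i - t $ i *\<^sub>R 1) * (a i - t $ i *\<^sub>R 1))"

lemma dist_sq_H: "dist_sq t \<in> H"
  unfolding dist_sq_def by (intro subspace_sum[OF subspace_H] H_intros a_H)

lemma char_dist_sq:
  assumes g: "character \<gamma>" shows "\<gamma> (dist_sq t) = complex_of_real ((dist (pt \<gamma>) t)\<^sup>2)"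
proof -
  have S: "(a i - t $ i *\<^sub>R 1) * (a i - t $ i *\<^sub>R 1) \<in> S" for i
    by (intro S_intros)
  have "\<gamma> (dist_sq t) = (\<Sum>i\<in>UNIV. \<gamma> ((a i - t $ i *\<^sub>R 1) * (a i - t $ i *\<^sub>R 1)))"
    unfolding dist_sq_def by (rule char_sum[OF g, THEN conjunct1]) (rule S)
  also have "\<dots> = (\<Sum>i\<in>UNIV. complex_of_real ((pt \<gamma> $ i - t $ i) * (pt \<gamma> $ i - t $ i)))"
    by (simp add: char_mult[OF g] char_diff[OF g] char_scaleR[OF g] char_one[OF g] char_a[OF g] S_intros)
  also have "\<dots> = complex_of_real ((dist (pt \<gamma>) t)\<^sup>2)"
    by (simp add: dist_norm power2_norm_eq_inner inner_vec_def)
  finally show ?thesis .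
qed

text \<open>The joint spectrum is closed because a point \<open>t\<close> outside of it has \<open>dist_sq t\<close> bounded below by a
  positive constant, which keeps all points of the joint spectrum away from \<open>t\<close>.\<close>

lemma compact_K: "compact K"
  unfolding compact_eq_bounded_closed
proof
  have "norm t \<le> (\<Sum>i\<in>UNIV. norm (a i))" if "t \<in> K" for t
  proof -
    obtain \<gamma> where g: "character \<gamma>" "pt \<gamma> = t" using K_pt[OF \<open>t \<in> K\<close>] .
    have "\<bar>t $ i\<bar> \<le> norm (a i)" for i
      using char_norm[OF g(1), of "a i"] by (simp add: char_a[OF g(1)] g(2))
    then show ?thesis using norm_le_l1_cart[of t] by (meson order_trans sum_mono)
  qed
  then show "bounded K" unfolding bounded_iff by blast
  show "closed K"
  proof (rule ccontr)
    assume "\<not> closed K"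
    then obtain t where t: "t \<in> closure K" "t \<notin> K"
      using closure_subset_eq[of K] by auto
    have "Re (\<gamma> (dist_sq t)) > 0" if "character \<gamma>" for \<gamma>
      using pt_K[OF that] t(2) by (auto simp: char_dist_sq[OF that])
    then have "\<exists>\<delta>>0. pos (dist_sq t - \<delta> *\<^sub>R 1)"
      by (intro pos_of_chars_strict dist_sq_H)
    then obtain \<delta> where d: "\<delta> > 0" "pos (dist_sq t - \<delta> *\<^sub>R 1)" by blast
    have "\<delta> \<le> (dist s t)\<^sup>2" if "s \<in> K" for s
    proof -
      obtain \<gamma> where g: "character \<gamma>" "pt \<gamma> = s" using K_pt[OF \<open>s \<in> K\<close>] .
      have "Re (\<gamma> (dist_sq t - \<delta> *\<^sub>R 1)) \<ge> 0"
        by (rule char_pos[OF g(1)]) (intro d(2) H_intros dist_sq_H)+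
      then show ?thesis
        by (simp add: char_diff[OF g(1)] char_scaleR[OF g(1)] char_one[OF g(1)] char_dist_sq[OF g(1)]
            H_S dist_sq_H S_intros g(2))
    qed
    moreover obtain s where "s \<in> K" "dist s t < sqrt \<delta>"
      using t(1) d(1) unfolding closure_approachable by (metis real_sqrt_gt_zero)
    ultimately show False
      using d(1) by (metis not_le real_le_rsqrt real_less_rsqrt real_sqrt_le_iff real_sqrt_pow2 less_imp_le power_strict_mono zero_le_dist zero_less_numeral)
  qed
qed

lemma polynomial_calculus:
  assumes "real_polynomial_function p"
  shows "\<exists>x\<in>H. \<forall>\<gamma>. character \<gamma> \<longrightarrow> \<gamma> x = complex_of_real (p (pt \<gamma>))"
  using assms
proof (induction rule: real_polynomial_function.induct)
  case (linear f)
  define x where "x = (\<Sum>i\<in>UNIV. f (axis i 1) *\<^sub>R a i)"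
  have "x \<in> H" unfolding x_def by (intro subspace_sum[OF subspace_H] H_intros a_H)
  moreover have "\<gamma> x = complex_of_real (f (pt \<gamma>))" if g: "character \<gamma>" for \<gamma>
  proof -
    have S: "f (axis i 1) *\<^sub>R a i \<in> S" for i by (intro S_intros)
    have "\<gamma> x = (\<Sum>i\<in>UNIV. \<gamma> (f (axis i 1) *\<^sub>R a i))"
      unfolding x_def by (rule char_sum[OF g, THEN conjunct1]) (rule S)
    also have "\<dots> = complex_of_real (\<Sum>i\<in>UNIV. pt \<gamma> $ i * f (axis i 1))"
      by (simp add: char_scaleR[OF g] char_a[OF g] mult.commute)
    also have "(\<Sum>i\<in>UNIV. pt \<gamma> $ i * f (axis i 1)) = f (\<Sum>i\<in>UNIV. pt \<gamma> $ i *\<^sub>R axis i 1)"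
      using bounded_linear.linear[OF linear] by (simp add: linear_sum linear_scale)
    also have "(\<Sum>i\<in>UNIV. pt \<gamma> $ i *\<^sub>R axis i 1) = pt \<gamma>"
      using basis_expansion[of "pt \<gamma>"] by (simp add: scalar_mult_eq_scaleR)
    finally show ?thesis .
  qed
  ultimately show ?case by blast
next
  case (const c)
  show ?case
    by (rule bexI[of _ "c *\<^sub>R 1"]) (auto simp: char_scaleR char_one intro: H_intros)
next
  case (add f g)
  then obtain x y where "x \<in> H" "y \<in> H"
    "\<And>\<gamma>. character \<gamma> \<Longrightarrow> \<gamma> x = complex_of_real (f (pt \<gamma>))"
    "\<And>\<gamma>. character \<gamma> \<Longrightarrow> \<gamma> y = complex_of_real (g (pt \<gamma>))" by blast
  then have "x + y \<in> H \<and> (\<forall>\<gamma>. character \<gamma> \<longrightarrow> \<gamma> (x + y) = complex_of_real (f (pt \<gamma>) + g (pt \<gamma>)))"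
    by (auto simp: char_add[OF _ H_S H_S] intro: H_intros)
  then show ?case by blast
next
  case (mult f g)
  then obtain x y where "x \<in> H" "y \<in> H"
    "\<And>\<gamma>. character \<gamma> \<Longrightarrow> \<gamma> x = complex_of_real (f (pt \<gamma>))"
    "\<And>\<gamma>. character \<gamma> \<Longrightarrow> \<gamma> y = complex_of_real (g (pt \<gamma>))" by blast
  then have "x * y \<in> H \<and> (\<forall>\<gamma>. character \<gamma> \<longrightarrow> \<gamma> (x * y) = complex_of_real (f (pt \<gamma>) * g (pt \<gamma>)))"
    by (auto simp: char_mult[OF _ H_S H_S] intro: H_intros)
  then show ?case by blast
qed

text \<open>Surjectivity of the Gelfand transform: approximate \<open>h\<close> by polynomials on the compact joint spectrum;
  the corresponding elements form a Cauchy sequence since the norm of a self-adjoint element is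
  controlled by its values under characters.\<close>

lemma real_calculus:
  fixes h :: "real ^ 'n \<Rightarrow> real"
  assumes h: "continuous_on K h"
  shows "\<exists>x\<in>H. \<forall>\<gamma>. character \<gamma> \<longrightarrow> \<gamma> x = complex_of_real (h (pt \<gamma>))"
proof -
  have "\<exists>x\<in>H. \<forall>\<gamma>. character \<gamma> \<longrightarrow> dist (\<gamma> x) (complex_of_real (h (pt \<gamma>))) < inverse (real (Suc n))" for n
  proof -
    obtain p where p: "real_polynomial_function p" "\<And>x. x \<in> K \<Longrightarrow> \<bar>h x - p x\<bar> < inverse (real (Suc n))"
      using Stone_Weierstrass_real_polynomial_function[OF compact_K h, of "inverse (real (Suc n))"]
      by auto
    obtain x where x: "x \<in> H" "\<And>\<gamma>. character \<gamma> \<Longrightarrow> \<gamma> x = complex_of_real (p (pt \<gamma>))"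
      using polynomial_calculus[OF p(1)] by blast
    have "dist (\<gamma> x) (complex_of_real (h (pt \<gamma>))) < inverse (real (Suc n))" if "character \<gamma>" for \<gamma>
      using p(2)[OF pt_K[OF that]] by (simp add: x(2)[OF that] dist_norm abs_minus_commute flip: of_real_diff)
    then show ?thesis using x(1) by blast
  qed
  then obtain u where uH: "\<And>n. u n \<in> H" and
    ud: "\<And>n \<gamma>. character \<gamma> \<Longrightarrow> dist (\<gamma> (u n)) (complex_of_real (h (pt \<gamma>))) < inverse (real (Suc n))"
    by metis
  have "Cauchy u"
  proof (rule metric_CauchyI)
    fix e :: real assume "e > 0"
    then obtain N where N: "inverse (real (Suc N)) < e / 4" using reals_Archimedean[of "e/4"] by auto
    have small: "inverse (real (Suc n)) < e / 4" if "n \<ge> N" for n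
      using N that by (meson inverse_le_iff_le le_less_trans of_nat_0_less_iff of_nat_le_iff Suc_le_mono zero_less_Suc less_imp_of_nat_less le_imp_inverse_le)
    have "dist (u m) (u n) < e" if "m \<ge> N" "n \<ge> N" for m n
    proof -
      have "norm (u m - u n) \<le> e / 2"
      proof (rule norm_le_of_chars)
        show "u m - u n \<in> H" by (intro H_intros uH)
        fix \<gamma> assume g: "character \<gamma>"
        have "dist (\<gamma> (u m)) (\<gamma> (u n)) \<le> e / 4 + e / 4"
          using ud[OF g, of m] ud[OF g, of n] small[OF that(1)] small[OF that(2)]
            dist_triangle2[of "\<gamma> (u m)" "\<gamma> (u n)" "complex_of_real (h (pt \<gamma>))"] by linarith
        then show "\<bar>Re (\<gamma> (u m - u n))\<bar> \<le> e / 2"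
          using abs_Re_le_cmod[of "\<gamma> (u m - u n)"]
          by (simp add: dist_norm char_diff[OF g] H_S uH)
      qed (use \<open>e > 0\<close> in simp)
      then show ?thesis using \<open>e > 0\<close> by (simp add: dist_norm)
    qed
    then show "\<exists>M. \<forall>m\<ge>M. \<forall>n\<ge>M. dist (u m) (u n) < e" by blast
  qed
  then obtain x where ux: "u \<longlonglongrightarrow> x" using Cauchy_convergent_iff convergent_def by blast
  have xH: "x \<in> H" using closed_sequentially[OF closed_H uH ux] .
  have "\<gamma> x = complex_of_real (h (pt \<gamma>))" if g: "character \<gamma>" for \<gamma>
  proof (rule LIMSEQ_unique)
    show "(\<lambda>n. \<gamma> (u n)) \<longlonglongrightarrow> \<gamma> x" by (rule char_tendsto[OF g H_S[OF uH] ux])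
    show "(\<lambda>n. \<gamma> (u n)) \<longlonglongrightarrow> complex_of_real (h (pt \<gamma>))"
      by (rule metric_tendsto_imp_tendsto[OF LIMSEQ_inverse_real_of_nat])
        (use ud[OF g] in \<open>auto intro!: always_eventually less_imp_le simp: dist_norm\<close>)
  qed
  then show ?thesis using xH by blast
qed

lemma complex_calculus:
  fixes h :: "real ^ 'n \<Rightarrow> complex"
  assumes h: "continuous_on K h"
  shows "\<exists>x\<in>S. \<forall>\<gamma>. character \<gamma> \<longrightarrow> \<gamma> x = h (pt \<gamma>)"
proof -
  obtain u where u: "u \<in> H" "\<And>\<gamma>. character \<gamma> \<Longrightarrow> \<gamma> u = complex_of_real (Re (h (pt \<gamma>)))"
    using real_calculus[OF continuous_on_Re[OF h]] by blast
  obtain v where v: "v \<in> H" "\<And>\<gamma>. character \<gamma> \<Longrightarrow> \<gamma> v = complex_of_real (Im (h (pt \<gamma>)))"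
    using real_calculus[OF continuous_on_Im[OF h]] by blast
  have "\<gamma> (u + \<i> *\<^sub>C v) = h (pt \<gamma>)" if g: "character \<gamma>" for \<gamma>
    by (simp add: char_add[OF g] char_scaleC[OF g] u v g H_S S_intros complex_eq_iff)
  moreover have "u + \<i> *\<^sub>C v \<in> S" using u v by (intro S_intros H_S)
  ultimately show ?thesis by blast
qed

text \<open>The inverse of the Gelfand transform, meaningful for functions that are continuous on the joint spectrum.\<close>

definition calc :: "(real ^ 'n \<Rightarrow> complex) \<Rightarrow> 'a" where
  "calc h = (THE x. x \<in> S \<and> (\<forall>\<gamma>. character \<gamma> \<longrightarrow> \<gamma> x = h (pt \<gamma>)))"

lemma calc_eqI:
  assumes "x \<in> S" "\<And>\<gamma>. character \<gamma> \<Longrightarrow> \<gamma> x = h (pt \<gamma>)" shows "calc h = x"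
  unfolding calc_def by (rule the_equality) (use assms in \<open>auto intro!: eq_of_chars\<close>)

lemma calc:
  assumes "continuous_on K h"
  shows calc_S: "calc h \<in> S" and char_calc: "character \<gamma> \<Longrightarrow> \<gamma> (calc h) = h (pt \<gamma>)"
proof -
  obtain x where x: "x \<in> S" "\<And>\<gamma>. character \<gamma> \<Longrightarrow> \<gamma> x = h (pt \<gamma>)"
    using complex_calculus[OF assms] by blast
  then have "calc h = x" by (rule calc_eqI)
  then show "calc h \<in> S" "character \<gamma> \<Longrightarrow> \<gamma> (calc h) = h (pt \<gamma>)" using x by auto
qed

lemma is_calculus_iso_calc: "is_calculus_iso a calc"
  unfolding is_calculus_iso_def Let_def
proof (intro conjI ballI allI)
  fix h :: "real ^ 'n \<Rightarrow> complex" assume "h \<in> {h. continuous_on K h}"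
  then have h: "continuous_on K h" by simp
  show "calc (\<lambda>x. c * h x) = c *\<^sub>C calc h" for c
    by (rule calc_eqI) (simp_all add: S_intros(4) calc_S[OF h] char_scaleC char_calc[OF h])
  show "calc (\<lambda>x. cnj (h x)) = star (calc h)"
    by (rule calc_eqI) (simp_all add: S_intros(5) calc_S[OF h] char_star char_calc[OF h])
  fix k :: "real ^ 'n \<Rightarrow> complex" assume "k \<in> {h. continuous_on K h}"
  then have k: "continuous_on K k" by simp
  show "calc (\<lambda>x. h x + k x) = calc h + calc k"
    by (rule calc_eqI) (simp_all add: S_intros(2) calc_S[OF h] calc_S[OF k] char_add
        char_calc[OF h] char_calc[OF k])
  show "calc (\<lambda>x. h x * k x) = calc h * calc k"
    by (rule calc_eqI) (simp_all add: S_intros(3) calc_S[OF h] calc_S[OF k] char_mult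
        char_calc[OF h] char_calc[OF k])
  show "calc h = calc k \<longleftrightarrow> (\<forall>x\<in>K. h x = k x)"
  proof
    assume eq: "calc h = calc k"
    show "\<forall>x\<in>K. h x = k x"
      using char_calc[OF h] char_calc[OF k] eq by (metis K_pt)
  next
    assume "\<forall>x\<in>K. h x = k x"
    then show "calc h = calc k"
      by (intro calc_eqI calc_S k) (simp add: char_calc[OF k] pt_K)
  qed
next
  show "calc (\<lambda>x. 1) = 1" by (rule calc_eqI) (simp_all add: char_one)
  show "calc (\<lambda>x. complex_of_real (x $ i)) = a i" for i
    by (rule calc_eqI) (simp_all add: char_a)
  show "calc ` {h. continuous_on K h} = S"
  proof
    show "calc ` {h. continuous_on K h} \<subseteq> S" using calc_S by blast
    show "S \<subseteq> calc ` {h. continuous_on K h}"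
    proof
      fix x assume x: "x \<in> S"
      have "calc (\<lambda>t. char_at t x) = x"
        by (rule calc_eqI[OF x]) (rule char_eq_char_at[OF _ x])
      then show "x \<in> calc ` {h. continuous_on K h}"
        using gelfand_continuous[OF x] by (metis imageI mem_Collect_eq)
    qed
  qed
qed

text \<open>Uniqueness needs no continuity of \<open>\<Phi>\<close>: if \<open>\<gamma> (\<Phi> h)\<close> differed from \<open>h\<close> at the point of \<open>\<gamma>\<close>,
  then \<open>\<gamma>\<close> would annihilate the image of a function without zeros.\<close>

lemma calculus_iso_unique:
  assumes iso: "is_calculus_iso a \<Phi>" and h: "continuous_on K h"
  shows "\<Phi> h = calc h"
proof -
  have add: "\<Phi> (\<lambda>x. p x + q x) = \<Phi> p + \<Phi> q" and mult: "\<Phi> (\<lambda>x. p x * q x) = \<Phi> p * \<Phi> q"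
    if "continuous_on K p" "continuous_on K q" for p q
    using iso that unfolding is_calculus_iso_def Let_def by auto
  have scale: "\<Phi> (\<lambda>x. c * p x) = c *\<^sub>C \<Phi> p" if "continuous_on K p" for c p
    using iso that unfolding is_calculus_iso_def Let_def by auto
  have one: "\<Phi> (\<lambda>x. 1) = 1" and coord: "\<Phi> (\<lambda>x. complex_of_real (x $ i)) = a i" for i
    using iso unfolding is_calculus_iso_def Let_def by auto
  have mem: "\<Phi> p \<in> S" if "continuous_on K p" for p
    using iso that unfolding is_calculus_iso_def Let_def by auto
  have eqK: "\<Phi> p = \<Phi> q" if "continuous_on K p" "continuous_on K q" "\<And>x. x \<in> K \<Longrightarrow> p x = q x" for p q
    using iso that unfolding is_calculus_iso_def Let_def by auto
  have "\<gamma> (\<Phi> h) = h (pt \<gamma>)" if g: "character \<gamma>" for \<gamma>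
  proof (rule ccontr)
    assume ne: "\<gamma> (\<Phi> h) \<noteq> h (pt \<gamma>)"
    define \<psi> where "\<psi> p = \<gamma> (\<Phi> p)" for p
    have padd: "\<psi> (\<lambda>x. p x + q x) = \<psi> p + \<psi> q" and pmult: "\<psi> (\<lambda>x. p x * q x) = \<psi> p * \<psi> q"
      if "continuous_on K p" "continuous_on K q" for p q
      using that by (simp_all add: \<psi>_def add mult mem char_add[OF g] char_mult[OF g])
    have pone: "\<psi> (\<lambda>x. 1) = 1" by (simp add: \<psi>_def one char_one[OF g])
    have pconst: "\<psi> (\<lambda>x. c) = c" for c
      using scale[of "\<lambda>x. 1" c] by (simp add: \<psi>_def one char_scaleC[OF g] char_one[OF g])
    have pcoord: "\<psi> (\<lambda>x. complex_of_real (x $ i)) = complex_of_real (pt \<gamma> $ i)" for i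
      by (simp add: \<psi>_def coord char_a[OF g])
    define c where "c = \<psi> h"
    define t where "t = pt \<gamma>"
    define k where "k = (\<lambda>x. h x + - c)"
    have kc: "continuous_on K k" unfolding k_def by (intro continuous_intros h)
    have pk: "\<psi> k = 0" unfolding k_def
      by (subst padd[OF h]) (simp_all add: pconst c_def)
    define d where "d i = (\<lambda>x::real ^ 'n. complex_of_real (x $ i) + complex_of_real (- (t $ i)))" for i
    have dc: "continuous_on K (d i)" for i unfolding d_def by (intro continuous_intros)
    have pd: "\<psi> (d i) = 0" for i
      unfolding d_def by (subst padd) (simp_all add: pconst pcoord t_def continuous_intros)
    have psum: "\<psi> (\<lambda>x. \<Sum>i\<in>A. d i x * d i x) = 0 \<and> continuous_on K (\<lambda>x. \<Sum>i\<in>A. d i x * d i x)"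
      if "finite A" for A
      using that
    proof (induction A)
      case empty
      then show ?case by (simp add: pconst)
    next
      case (insert i A)
      have "\<psi> (\<lambda>x. d i x * d i x + (\<Sum>i\<in>A. d i x * d i x)) = 0"
        using insert.IH by (subst padd) (auto simp: pmult dc pd intro!: continuous_intros)
      moreover have "continuous_on K (\<lambda>x. d i x * d i x + (\<Sum>i\<in>A. d i x * d i x))"
        using insert.IH by (auto intro!: continuous_intros dc)
      ultimately show ?case using insert.hyps by simp
    qed
    define w where "w = (\<lambda>x. cnj (k x) * k x + (\<Sum>i\<in>UNIV. d i x * d i x))"
    have cc: "continuous_on K (\<lambda>x. cnj (k x))" by (intro continuous_intros kc)
    have wc: "continuous_on K w"
      unfolding w_def by (intro continuous_intros cc kc dc)
    have pw: "\<psi> w = 0"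
      unfolding w_def using psum[of UNIV]
      by (subst padd) (auto simp: pmult cc kc pk intro!: continuous_intros cc kc dc)
    have wx: "w x = complex_of_real ((cmod (k x))\<^sup>2 + (dist x t)\<^sup>2)" for x
    proof -
      have "cnj (k x) * k x = complex_of_real ((cmod (k x))\<^sup>2)"
        by (metis complex_norm_square mult.commute)
      moreover have "(\<Sum>i\<in>UNIV. d i x * d i x) = complex_of_real ((dist x t)\<^sup>2)"
        by (simp add: d_def dist_norm power2_norm_eq_inner inner_vec_def)
      ultimately show ?thesis by (simp add: w_def)
    qed
    have kt: "k t \<noteq> 0" using ne by (simp add: k_def c_def \<psi>_def t_def)
    have wnz: "w x \<noteq> 0" for x
    proof
      assume "w x = 0"
      then have "(cmod (k x))\<^sup>2 + (dist x t)\<^sup>2 = 0" unfolding wx by (simp only: of_real_eq_0_iff)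
      then have *: "cmod (k x) = 0 \<and> dist x t = 0" by (simp only: sum_power2_eq_zero_iff)
      have "k x = 0" "x = t" using conjunct1[OF *] conjunct2[OF *] by simp_all
      then show False using kt by simp
    qed
    have ic: "continuous_on K (\<lambda>x. inverse (w x))" by (intro continuous_on_inverse wc) (use wnz in auto)
    have "\<psi> (\<lambda>x. w x * inverse (w x)) = 0" by (simp add: pmult wc ic pw)
    moreover have "(\<lambda>x. w x * inverse (w x)) = (\<lambda>x. 1)" using wnz by (simp add: fun_eq_iff)
    ultimately show False using pone by simp
  qed
  then show ?thesis by (intro calc_eqI[symmetric] mem h) auto
qed

theorem func_calc:
  assumes f: "continuous_on K f"
  shows func_calc_H: "func_calc f a \<in> H"
    and char_func_calc: "character \<gamma> \<Longrightarrow> \<gamma> (func_calc f a) = complex_of_real (f (pt \<gamma>))"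
proof -
  have fc: "continuous_on K (\<lambda>x. complex_of_real (f x))" by (intro continuous_intros f)
  have eq: "func_calc f a = calc (\<lambda>x. complex_of_real (f x))"
    unfolding func_calc_def
    by (rule the_equality) (use is_calculus_iso_calc calculus_iso_unique[OF _ fc] in blast)+
  then show g: "character \<gamma> \<Longrightarrow> \<gamma> (func_calc f a) = complex_of_real (f (pt \<gamma>))" for \<gamma>
    by (simp add: char_calc[OF fc])
  have FS: "func_calc f a \<in> S" using eq calc_S[OF fc] by simp
  have "star (func_calc f a) = func_calc f a"
    by (rule eq_of_chars) (simp_all add: FS S_intros(5) char_star g)
  then show "func_calc f a \<in> H" using FS by (simp add: H_def)
qed

end

section \<open>Positivity and positive maps\<close>

lemma positive_in_UNIV_iff: "positive_in UNIV x \<longleftrightarrow> pos x"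
proof
  show "positive_in UNIV x \<Longrightarrow> pos x" by (auto simp: positive_in_def pos_star_mult)
  assume "pos x"
  then obtain v where "v * v = x" "pos v" using pos_sqrt by metis
  then show "positive_in UNIV x" unfolding positive_in_def by (metis UNIV_I pos_star)
qed

text \<open>The square root of a positive element of \<open>C\<close> lies in \<open>C\<close>, even if \<open>C\<close> does not contain the unit.\<close>

lemma positive_in_subalgebra:
  assumes "cstar_subalgebra C" "x \<in> C" "pos x" shows "positive_in C x"
proof -
  obtain v where v: "v * v = x" "pos v"
    "\<And>T. \<lbrakk>closed T; subspace T; \<And>z. z \<in> T \<Longrightarrow> z * z \<in> T; x \<in> T\<rbrakk> \<Longrightarrow> v \<in> T"
    using pos_sqrt[OF assms(3)] by blast
  have "v \<in> C" by (rule v(3)) (use assms cstar_subalgebraD[OF assms(1)] in auto)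
  then show ?thesis unfolding positive_in_def using v(1,2) by (metis pos_star)
qed

text \<open>Positive complex-linear maps, not required to be unital.\<close>

locale positive_map =
  fixes \<phi> :: "'a::cstar_algebra \<Rightarrow> 'b::cstar_algebra"
  assumes clinear: "clinear_map \<phi>" and pos_pos: "\<And>x. pos x \<Longrightarrow> pos (\<phi> x)"
begin

lemma add: "\<phi> (x + y) = \<phi> x + \<phi> y" and scaleC: "\<phi> (c *\<^sub>C x) = c *\<^sub>C \<phi> x"
  using clinear by (auto simp: clinear_map_def)

lemma scaleR: "\<phi> (r *\<^sub>R x) = r *\<^sub>R \<phi> x"
  using scaleC[of "complex_of_real r" x] by (simp add: scaleC_of_real)

lemma zero: "\<phi> 0 = 0" using scaleR[of 0 0] by simp

lemma diff: "\<phi> (x - y) = \<phi> x - \<phi> y"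
  using add[of x "(-1) *\<^sub>R y"] scaleR[of "-1" y] by simp

lemma sum: "\<phi> (sum f A) = (\<Sum>i\<in>A. \<phi> (f i))"
  by (induction A rule: infinite_finite_induct) (simp_all add: zero add)

lemma selfadj:
  assumes "star x = x" shows "star (\<phi> x) = \<phi> x"
proof -
  have "pos (norm x *\<^sub>R 1 + x)" "pos (norm x *\<^sub>R 1)"
    by (rule pos_norm_diff(2)[OF assms order_refl]) (rule pos_const[OF norm_ge_zero])
  then have "pos (\<phi> (norm x *\<^sub>R 1 + x))" "pos (\<phi> (norm x *\<^sub>R 1))" using pos_pos by auto
  moreover have "\<phi> x = \<phi> (norm x *\<^sub>R 1 + x) - \<phi> (norm x *\<^sub>R 1)" by (simp add: add)
  ultimately show ?thesis by (simp only: star_diff pos_star)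
qed

lemma star: "\<phi> (star x) = star (\<phi> x)"
proof -
  have "\<phi> (star (re_part x + \<i> *\<^sub>C im_part x)) = star (\<phi> (re_part x + \<i> *\<^sub>C im_part x))"
    by (simp only: star_add star_scaleC star_re_part star_im_part add scaleC selfadj)
  then show ?thesis by (simp only: re_im_decompose[symmetric])
qed

end

lemma centralizer_subalgebra:
  assumes "positive_map E" "bounded_linear E"
  shows "cstar_subalgebra (centralizer E)" "1 \<in> centralizer E"
proof -
  interpret positive_map E by fact
  have cont: "continuous_on UNIV (\<lambda>b. E (f b))" if "continuous_on UNIV f" for f
    using bounded_linear.continuous_on[OF assms(2) that] .
  show "1 \<in> centralizer E" by (simp add: centralizer_def)
  show "cstar_subalgebra (centralizer E)"
  proof (rule cstar_subalgebraI)
    have "centralizer E = (\<Inter>x. {b. E (b * x) = E (x * b)})" by (auto simp: centralizer_def)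
    also have "closed \<dots>"
      by (intro closed_INT ballI closed_Collect_eq cont continuous_intros)
    finally show "closed (centralizer E)" .
    show "0 \<in> centralizer E" by (simp add: centralizer_def)
    fix b assume "b \<in> centralizer E"
    then have b: "E (b * x) = E (x * b)" for x by (simp add: centralizer_def)
    show "c *\<^sub>C b \<in> centralizer E" for c
      by (simp add: centralizer_def mult_scaleC_left mult_scaleC_right scaleC b)
    show "star b \<in> centralizer E"
      unfolding centralizer_def
    proof (intro CollectI allI)
      fix x
      have "E (star b * x) = star (E (star x * b))" by (simp add: star_mult star_star flip: star)
      also have "\<dots> = star (E (b * star x))" by (simp add: b)
      also have "\<dots> = E (x * star b)" by (simp add: star_mult star_star flip: star)
      finally show "E (star b * x) = E (x * star b)" .
    qed
    fix d assume "d \<in> centralizer E"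
    then have d: "E (d * x) = E (x * d)" for x by (simp add: centralizer_def)
    show "b + d \<in> centralizer E"
      by (simp add: centralizer_def distrib_left distrib_right add b d)
    have "E (b * d * x) = E (x * (b * d))" for x
      using b[of "d * x"] d[of "x * b"] by (simp add: mult.assoc)
    then show "b * d \<in> centralizer E" by (simp add: centralizer_def)
  qed
qed

section \<open>Affine functions and supporting hyperplanes\<close>

text \<open>Existence of subgradients, by separating the epigraph from the open ray below \<open>(t, f t)\<close>. As \<open>U\<close> is open, the
  separating hyperplane is not vertical.\<close>

lemma convex_subgradient:
  fixes f :: "'x::euclidean_space \<Rightarrow> real"
  assumes U: "open U" and f: "convex_on U f" and t: "t \<in> U"
  shows "\<exists>v. \<forall>x\<in>U. f t + v \<bullet> (x - t) \<le> f x"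
proof -
  let ?L = "{t} \<times> {..<f t}"
  have cl: "convex ?L" by (intro convex_Times convex_singleton) simp
  have ne: "?L \<noteq> {}" "epigraph U f \<noteq> {}"
    using t lt_ex by (auto simp: epigraph_def)
  have disj: "?L \<inter> epigraph U f = {}" by (auto simp: epigraph_def)
  obtain p b where p: "p \<noteq> 0" "\<And>z. z \<in> ?L \<Longrightarrow> p \<bullet> z \<le> b" "\<And>z. z \<in> epigraph U f \<Longrightarrow> p \<bullet> z \<ge> b"
    using separating_hyperplane_sets[OF cl convex_epigraphI[OF f] ne disj] by blast
  obtain v \<alpha> where pv: "p = (v, \<alpha>)" by (cases p)
  have low: "v \<bullet> t + \<alpha> * y \<le> b" if "y < f t" for y
    using p(2)[of "(t, y)"] that by (simp add: pv)
  have up: "b \<le> v \<bullet> x + \<alpha> * f x" if "x \<in> U" for x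
    using p(3)[of "(x, f x)"] that by (simp add: pv mem_epigraph)
  have "v \<bullet> t + \<alpha> * (f t - 1) \<le> v \<bullet> t + \<alpha> * f t" using low[of "f t - 1"] up[OF t] by simp
  then have a0: "\<alpha> \<ge> 0" by (simp add: algebra_simps)
  have "\<alpha> \<noteq> 0"
  proof
    assume a: "\<alpha> = 0"
    then have v0: "v \<noteq> 0" using p(1) pv by (simp add: zero_prod_def)
    have ge: "v \<bullet> t \<le> v \<bullet> x" if "x \<in> U" for x
      using low[of "f t - 1"] up[OF that] a by simp
    obtain e where e: "e > 0" "cball t e \<subseteq> U" using U t open_contains_cball by blast
    have "t - (e / norm v) *\<^sub>R v \<in> cball t e" using e v0 by (simp add: dist_norm)
    then have "v \<bullet> t \<le> v \<bullet> (t - (e / norm v) *\<^sub>R v)" using ge e by blast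
    then have "(e / norm v) * (v \<bullet> v) \<le> 0" by (simp add: inner_diff_right)
    moreover have "(e / norm v) * (v \<bullet> v) > 0" using e v0 by simp
    ultimately show False by simp
  qed
  then have a: "\<alpha> > 0" using a0 by simp
  have lim: "v \<bullet> t + \<alpha> * f t \<le> b"
  proof (rule field_le_epsilon)
    fix e :: real assume "e > 0"
    then have "v \<bullet> t + \<alpha> * (f t - e / \<alpha>) \<le> b" using a by (intro low) simp
    then show "v \<bullet> t + \<alpha> * f t \<le> b + e" using a by (simp add: right_diff_distrib)
  qed
  have "f t + (- (1 / \<alpha>) *\<^sub>R v) \<bullet> (x - t) \<le> f x" if "x \<in> U" for x
  proof -
    have "\<alpha> * f t - v \<bullet> (x - t) \<le> \<alpha> * f x"
      using lim up[OF that] by (simp add: inner_diff_right)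
    then show ?thesis using a by (simp add: field_simps)
  qed
  then show ?thesis by blast
qed

text \<open>The value of the affine function \<open>x \<mapsto> v \<bullet> x + c\<close> at a tuple of algebra elements.\<close>

definition affine_at :: "('n::finite \<Rightarrow> 'a::cstar_algebra) \<Rightarrow> real ^ 'n \<Rightarrow> real \<Rightarrow> 'a" where
  "affine_at a v c = (\<Sum>i\<in>UNIV. v $ i *\<^sub>R a i) + c *\<^sub>R 1"

lemma (in positive_map) affine_at:
  "\<phi> 1 = 1 \<Longrightarrow> \<phi> (affine_at a v c) = affine_at (\<lambda>i. \<phi> (a i)) v c"
  by (simp add: affine_at_def add sum scaleR)

context commuting_family
begin

lemma affine_at_H: "affine_at a v c \<in> H"
  unfolding affine_at_def by (intro H_intros subspace_sum[OF subspace_H] a_H)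

lemma char_affine_at:
  assumes g: "character \<gamma>" shows "\<gamma> (affine_at a v c) = complex_of_real (v \<bullet> pt \<gamma> + c)"
proof -
  have S: "v $ i *\<^sub>R a i \<in> S" for i by (intro S_intros)
  have "\<gamma> (\<Sum>i\<in>UNIV. v $ i *\<^sub>R a i) = (\<Sum>i\<in>UNIV. \<gamma> (v $ i *\<^sub>R a i))"
    and "(\<Sum>i\<in>UNIV. v $ i *\<^sub>R a i) \<in> S"
    using char_sum[OF g, of UNIV "\<lambda>i. v $ i *\<^sub>R a i"] S by auto
  then show ?thesis
    by (simp add: affine_at_def char_add[OF g] char_scaleR[OF g] char_one[OF g] char_a[OF g]
        S_intros inner_vec_def)
qed

text \<open>The value of a character at \<open>a i\<close> lies in the spectrum of \<open>a i\<close> in the whole algebra, not only in the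
  spectrum relative to \<open>S\<close>: if \<open>w = a i - \<gamma>(a i)\<close> had an inverse anywhere, then \<open>w\<^sup>2 \<ge> \<delta>\<close> for some \<open>\<delta> > 0\<close>, but
  \<open>\<gamma>(w\<^sup>2) = 0\<close>.\<close>

lemma pt_spectrum:
  assumes g: "character \<gamma>" shows "complex_of_real (pt \<gamma> $ i) \<in> spectrum (a i)"
  unfolding spectrum_def
proof (intro CollectI notI)
  define w where "w = a i - pt \<gamma> $ i *\<^sub>R 1"
  assume "\<exists>b. (a i - complex_of_real (pt \<gamma> $ i) *\<^sub>C 1) * b = 1 \<and>
              b * (a i - complex_of_real (pt \<gamma> $ i) *\<^sub>C 1) = 1"
  then obtain d where d: "w * d = 1" "d * w = 1" unfolding w_def scaleC_of_real by blast
  have wH: "w \<in> H" unfolding w_def by (intro H_intros a_H)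
  have gw: "\<gamma> w = 0"
    by (simp add: w_def char_diff[OF g] char_scaleR[OF g] char_one[OF g] char_a[OF g] S_intros)
  have "w * w * (d * d) = w * (w * d) * d" "d * d * (w * w) = d * (d * w) * w"
    by (simp_all only: mult.assoc)
  then have "w * w * (d * d) = 1" "d * d * (w * w) = 1" using d by simp_all
  then obtain \<delta> where dl: "\<delta> > 0" "pos (w * w - \<delta> *\<^sub>R 1)"
    using pos_invertible_bound[OF pos_square[OF star_H[OF wH]]] by blast
  have "Re (\<gamma> (w * w - \<delta> *\<^sub>R 1)) \<ge> 0"
    by (rule char_pos[OF g _ dl(2)]) (intro H_intros wH)
  then show False
    using dl(1) by (simp add: char_diff[OF g] char_mult[OF g] char_scaleR[OF g] char_one[OF g] gw
        H_S wH S_intros)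
qed

lemma K_nonempty: "K \<noteq> {}"
proof
  assume "K = {}"
  then have "\<not> character \<gamma>" for \<gamma> using pt_K by blast
  then have "(1::'a) = 0" by (intro eq_of_chars) (auto intro: S_intros)
  then show False by simp
qed

lemma func_calc_bounds:
  assumes f: "continuous_on K f" and b: "\<And>x. x \<in> K \<Longrightarrow> m \<le> f x \<and> f x \<le> M"
  shows "pos (func_calc f a - m *\<^sub>R 1)" "pos (M *\<^sub>R 1 - func_calc f a)"
proof -
  show "pos (func_calc f a - m *\<^sub>R 1)"
  proof (rule pos_of_chars)
    show "Re (\<gamma> (func_calc f a - m *\<^sub>R 1)) \<ge> 0" if g: "character \<gamma>" for \<gamma>
      using b[OF pt_K[OF g]] by (simp add: char_diff[OF g] char_scaleR[OF g] char_one[OF g]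
        char_func_calc[OF f g] H_S func_calc_H[OF f] S_intros)
  qed (intro H_intros func_calc_H[OF f])
  show "pos (M *\<^sub>R 1 - func_calc f a)"
  proof (rule pos_of_chars)
    show "Re (\<gamma> (M *\<^sub>R 1 - func_calc f a)) \<ge> 0" if g: "character \<gamma>" for \<gamma>
      using b[OF pt_K[OF g]] by (simp add: char_diff[OF g] char_scaleR[OF g] char_one[OF g]
        char_func_calc[OF f g] H_S func_calc_H[OF f] S_intros)
  qed (intro H_intros func_calc_H[OF f])
qed

lemma affine_minorant_func_calc:
  assumes f: "continuous_on K f" and le: "\<And>x. x \<in> K \<Longrightarrow> v \<bullet> x + c \<le> f x"
  shows "pos (func_calc f a - affine_at a v c)"
proof (rule pos_of_chars)
  show "Re (\<gamma> (func_calc f a - affine_at a v c)) \<ge> 0" if g: "character \<gamma>" for \<gamma>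
    using le[OF pt_K[OF g]] by (simp add: char_diff[OF g] char_affine_at[OF g]
        char_func_calc[OF f g] H_S func_calc_H[OF f] affine_at_H)
qed (intro H_intros func_calc_H[OF f] affine_at_H)

end

section \<open>Functional calculus of a single element\<close>

text \<open>A single element \<open>T\<close> with \<open>m \<le> T \<le> M\<close>, regarded as a commuting family with one member. The bounds on \<open>T\<close>
  confine its spectrum to \<open>[m, M]\<close>.\<close>

locale bounded_selfadj =
  fixes T :: "'a::cstar_algebra" and m M :: real
  assumes lower: "pos (T - m *\<^sub>R 1)" and upper: "pos (M *\<^sub>R 1 - T)"
begin

lemma star_T: "star T = T"
proof -
  have "star (T - m *\<^sub>R 1) = T - m *\<^sub>R 1" using lower by (rule pos_star)
  then show ?thesis by (simp add: star_diff)
qed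

sublocale single: commuting_family "\<lambda>_::1. T"
  by unfold_locales (auto simp: star_T)

lemma pt_range: assumes g: "single.character \<gamma>" shows "single.pt \<gamma> $ 1 \<in> {m..M}"
proof -
  note s = single.char_diff[OF g] single.char_scaleR[OF g] single.char_one[OF g]
    single.S_intros single.pt_def
  have T: "T \<in> single.H" using single.a_H by simp
  then have "Re (\<gamma> (T - m *\<^sub>R 1)) \<ge> 0" "Re (\<gamma> (M *\<^sub>R 1 - T)) \<ge> 0"
    by (intro single.char_pos[OF g] lower upper single.H_intros; assumption)+
  then show ?thesis
    using single.H_S[OF T] by (simp add: s)
qed

lemma K_range: "x \<in> single.K \<Longrightarrow> x $ 1 \<in> {m..M}"
  using pt_range by (metis single.K_pt)

lemma
  assumes g: "continuous_on {m..M} g"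
  shows func_calc1_H: "func_calc1 g T \<in> single.H"
    and char_func_calc1:
      "single.character \<gamma> \<Longrightarrow> \<gamma> (func_calc1 g T) = complex_of_real (g (single.pt \<gamma> $ 1))"
proof -
  have c: "continuous_on single.K (\<lambda>x. g (x $ 1))"
    by (rule continuous_on_compose2[OF g]) (use K_range in \<open>auto intro!: continuous_intros\<close>)
  show "func_calc1 g T \<in> single.H" unfolding func_calc1_def by (rule single.func_calc_H[OF c])
  show "single.character \<gamma> \<Longrightarrow> \<gamma> (func_calc1 g T) = complex_of_real (g (single.pt \<gamma> $ 1))"
    unfolding func_calc1_def by (rule single.char_func_calc[OF c])
qed

lemma tangent_func_calc1:
  assumes g: "continuous_on {m..M} g" and le: "\<And>u. u \<in> {m..M} \<Longrightarrow> g s + \<beta> * (u - s) \<le> g u"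
  shows "pos (func_calc1 g T - (g s *\<^sub>R 1 + \<beta> *\<^sub>R (T - s *\<^sub>R 1)))"
proof (rule single.pos_of_chars)
  have T: "T \<in> single.H" using single.a_H by simp
  show "func_calc1 g T - (g s *\<^sub>R 1 + \<beta> *\<^sub>R (T - s *\<^sub>R 1)) \<in> single.H"
    by (intro single.H_intros func_calc1_H[OF g] T)
  fix \<gamma> assume c: "single.character \<gamma>"
  have "\<gamma> (func_calc1 g T - (g s *\<^sub>R 1 + \<beta> *\<^sub>R (T - s *\<^sub>R 1)))
      = complex_of_real (g (single.pt \<gamma> $ 1) - (g s + \<beta> * (single.pt \<gamma> $ 1 - s)))"
    by (simp add: single.char_diff[OF c] single.char_add[OF c] single.char_scaleR[OF c]
        single.char_one[OF c] char_func_calc1[OF g c] single.char_a[OF c]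
        single.S_intros single.H_S func_calc1_H[OF g] T)
  then show "Re (\<gamma> (func_calc1 g T - (g s *\<^sub>R 1 + \<beta> *\<^sub>R (T - s *\<^sub>R 1)))) \<ge> 0"
    using le[OF pt_range[OF c]] by simp
qed

end

text \<open>The composition rule \<open>g(f(a)) = (g \<circ> f)(a)\<close>, expressed through characters of \<open>S\<close>; these restrict to characters of
  the algebra generated by \<open>f(a)\<close>.\<close>

lemma (in commuting_family) func_calc1_func_calc:
  assumes f: "continuous_on K f" and b: "\<And>x. x \<in> K \<Longrightarrow> m \<le> f x \<and> f x \<le> M"
    and g: "continuous_on {m..M} g"
  shows "func_calc1 g (func_calc f a) \<in> H"
    and "character \<gamma> \<Longrightarrow> \<gamma> (func_calc1 g (func_calc f a)) = complex_of_real (g (f (pt \<gamma>)))"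
proof -
  let ?F = "func_calc f a"
  interpret F: bounded_selfadj ?F m M
    by unfold_locales (rule func_calc_bounds[OF f b]; assumption)+
  have sub: "F.single.S \<subseteq> S"
    by (rule cstar_generated_minimal) (simp_all add: cstar_generated_subalgebra H_S func_calc_H[OF f])
  have "func_calc1 g ?F \<in> F.single.H" by (rule F.func_calc1_H[OF g])
  then show "func_calc1 g ?F \<in> H" using sub by (auto simp: F.single.H_def H_def)
  assume c: "character \<gamma>"
  have c': "F.single.character \<gamma>"
    unfolding is_character_def
  proof (intro conjI)
    show "\<exists>x\<in>F.single.S. \<gamma> x \<noteq> 0" by (rule bexI[of _ 1]) (simp_all add: char_one[OF c])
  qed (use c sub in \<open>auto simp: is_character_def subset_iff\<close>)
  have "F.single.pt \<gamma> $ 1 = f (pt \<gamma>)"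
    by (simp add: F.single.pt_def char_func_calc[OF f c])
  then show "\<gamma> (func_calc1 g ?F) = complex_of_real (g (f (pt \<gamma>)))"
    using F.char_func_calc1[OF g c'] by simp
qed

section \<open>Comparison under the conditional expectation\<close>

text \<open>The element \<open>Y\<close> is \<open>G(a)\<close>. If \<open>X\<close> dominates, for each point \<open>t\<close> of the joint spectrum, an affine function of
  \<open>a\<close> that equals \<open>G\<close> at \<open>t\<close>, then \<open>E X \<ge> E Y\<close>, although \<open>X\<close> need not commute with \<open>a\<close>.\<close>

lemma (in commuting_family) expectation_ge_of_affine_minorants:
  fixes G :: "real ^ 'n \<Rightarrow> real"
  assumes E: "positive_map E" "bounded_linear E" and cent: "\<And>i. a i \<in> centralizer E"
    and G: "continuous_on K G"
    and Y: "Y \<in> H" "\<And>\<gamma>. character \<gamma> \<Longrightarrow> \<gamma> Y = complex_of_real (G (pt \<gamma>))"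
    and minor: "\<And>t. t \<in> K \<Longrightarrow> \<exists>v c. v \<bullet> t + c = G t \<and> pos (X - affine_at a v c)"
  shows "pos (E X - E Y)"
proof (rule pos_epsilon)
  interpret E: positive_map E by fact
  have S_cent: "S \<subseteq> centralizer E"
    by (rule cstar_generated_minimal) (use centralizer_subalgebra[OF E] cent in auto)
  fix e :: real assume e: "e > 0"
  obtain v c where vc: "\<And>t. t \<in> K \<Longrightarrow> v t \<bullet> t + c t = G t"
    "\<And>t. t \<in> K \<Longrightarrow> pos (X - affine_at a (v t) (c t))"
    using minor by metis
  \<comment> \<open>The positive part of the margin by which the minorant at \<open>t\<close> exceeds \<open>G - e\<close>; it is positive near \<open>t\<close>.\<close>
  define h where "h t x = max 0 (v t \<bullet> x + c t - G x + e)" for t x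
  have hc: "continuous_on K (h t)" for t unfolding h_def by (intro continuous_intros G)
  have h0: "h t x \<ge> 0" for t x by (simp add: h_def)
  have htt: "h t t > 0" if "t \<in> K" for t using vc(1)[OF that] e by (simp add: h_def)
  have "\<exists>D\<subseteq>(\<lambda>t. K \<inter> h t -` {0<..}) ` K. finite D \<and> K \<subseteq> \<Union>D"
    using compact_K htt unfolding compact_eq_openin_cover
    by (elim allE[of _ "(\<lambda>t. K \<inter> h t -` {0<..}) ` K"] impE)
      (auto intro!: continuous_openin_preimage_gen hc)
  then obtain D where D: "D \<subseteq> (\<lambda>t. K \<inter> h t -` {0<..}) ` K" "finite D" "K \<subseteq> \<Union>D"
    by (elim exE conjE)
  then obtain F where F: "F \<subseteq> K" "finite F" and DF: "D = (\<lambda>t. K \<inter> h t -` {0<..}) ` F"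
    using finite_subset_image[OF D(2,1)] by blast
  have F3: "K \<subseteq> (\<Union>t\<in>F. K \<inter> h t -` {0<..})" using D(3) by (simp only: DF)
  define w where "w x = (\<Sum>t\<in>F. h t x)" for x
  have wc: "continuous_on K w" unfolding w_def by (intro continuous_intros hc)
  have wpos: "w x > 0" if "x \<in> K" for x
  proof -
    obtain t where "t \<in> F" "h t x > 0" using F3 \<open>x \<in> K\<close> by auto
    then show ?thesis unfolding w_def using F(2) h0 by (intro sum_pos2) auto
  qed
  \<comment> \<open>The squares of the functions \<open>k t\<close> with \<open>t \<in> F\<close> form a partition of unity on \<open>K\<close>.\<close>
  define k where "k t x = sqrt (h t x / w x)" for t x
  have kc: "continuous_on K (k t)" for t
    unfolding k_def by (intro continuous_intros hc wc) (use wpos in force)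
  have kk: "k t x * k t x = h t x / w x" if "x \<in> K" for t x
    using h0[of t x] wpos[OF that] by (simp add: k_def)
  have k1: "(\<Sum>t\<in>F. k t x * k t x) = 1" if "x \<in> K" for x
    using wpos[OF that] by (simp add: kk[OF that] w_def flip: sum_divide_distrib)
  obtain \<kappa> where \<kappa>H: "\<And>t. \<kappa> t \<in> H"
    and \<kappa>: "\<And>t \<gamma>. character \<gamma> \<Longrightarrow> \<gamma> (\<kappa> t) = complex_of_real (k t (pt \<gamma>))"
    using real_calculus[OF kc] by metis
  have \<kappa>S: "\<kappa> t \<in> S" for t by (rule H_S[OF \<kappa>H])
  have one: "(\<Sum>t\<in>F. \<kappa> t * \<kappa> t) = 1"
  proof (rule eq_of_chars)
    show "(\<Sum>t\<in>F. \<kappa> t * \<kappa> t) \<in> S"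
      by (intro H_S subspace_sum[OF subspace_H] mult_H \<kappa>H)
    fix \<gamma> assume g: "character \<gamma>"
    have "\<gamma> (\<Sum>t\<in>F. \<kappa> t * \<kappa> t) = (\<Sum>t\<in>F. \<gamma> (\<kappa> t * \<kappa> t))"
      by (rule char_sum[OF g, THEN conjunct1]) (intro S_intros \<kappa>S)
    also have "\<dots> = complex_of_real (\<Sum>t\<in>F. k t (pt \<gamma>) * k t (pt \<gamma>))"
      by (simp add: char_mult[OF g \<kappa>S \<kappa>S] \<kappa>[OF g])
    finally show "\<gamma> (\<Sum>t\<in>F. \<kappa> t * \<kappa> t) = \<gamma> 1"
      by (simp only: k1[OF pt_K[OF g]] char_one[OF g] of_real_1)
  qed simp
  define A where "A t = affine_at a (v t) (c t)" for t
  have AH: "A t \<in> H" for t unfolding A_def by (rule affine_at_H)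
  define Z where "Z = (\<Sum>t\<in>F. \<kappa> t * A t * \<kappa> t) - Y + e *\<^sub>R 1"
  have sumH: "(\<Sum>t\<in>F. \<kappa> t * A t * \<kappa> t) \<in> H"
    by (intro subspace_sum[OF subspace_H] mult_H \<kappa>H AH)
  have Zpos: "pos Z"
  proof (rule pos_of_chars)
    show "Z \<in> H" unfolding Z_def by (intro H_intros sumH Y)
    fix \<gamma> assume g: "character \<gamma>"
    let ?x = "pt \<gamma>"
    have x: "?x \<in> K" by (rule pt_K[OF g])
    have "\<gamma> (\<Sum>t\<in>F. \<kappa> t * A t * \<kappa> t) = (\<Sum>t\<in>F. \<gamma> (\<kappa> t * A t * \<kappa> t))"
      by (rule char_sum[OF g, THEN conjunct1]) (intro S_intros \<kappa>S H_S[OF AH])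
    also have "\<dots> = complex_of_real (\<Sum>t\<in>F. k t ?x * k t ?x * (v t \<bullet> ?x + c t))"
      by (simp add: char_mult[OF g] \<kappa>[OF g] \<kappa>S H_S AH S_intros mult.commute mult.left_commute
          char_affine_at[OF g] A_def affine_at_H)
    finally have "\<gamma> Z = complex_of_real
        ((\<Sum>t\<in>F. k t ?x * k t ?x * (v t \<bullet> ?x + c t)) - G ?x + e)"
      unfolding Z_def
      by (simp add: char_add[OF g] char_diff[OF g] char_scaleR[OF g] char_one[OF g] Y(2)[OF g]
          H_S sumH Y(1) S_intros)
    also have "(\<Sum>t\<in>F. k t ?x * k t ?x * (v t \<bullet> ?x + c t)) - G ?x + e
        = (\<Sum>t\<in>F. k t ?x * k t ?x * (v t \<bullet> ?x + c t)) - (\<Sum>t\<in>F. k t ?x * k t ?x) * (G ?x - e)"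
      by (simp add: k1[OF x])
    also have "\<dots> = (\<Sum>t\<in>F. k t ?x * k t ?x * (v t \<bullet> ?x + c t - G ?x + e))"
      unfolding sum_distrib_right sum_subtractf[symmetric]
      by (intro sum.cong refl) (simp add: algebra_simps)
    finally have "Re (\<gamma> Z) = (\<Sum>t\<in>F. k t ?x * k t ?x * (v t \<bullet> ?x + c t - G ?x + e))" by simp
    moreover have "k t ?x * k t ?x * (v t \<bullet> ?x + c t - G ?x + e) \<ge> 0" for t
    proof (cases "v t \<bullet> ?x + c t - G ?x + e \<ge> 0")
      case False
      then have "h t ?x = 0" by (simp add: h_def)
      then show ?thesis by (simp add: k_def)
    qed simp
    ultimately show "Re (\<gamma> Z) \<ge> 0" by (simp add: sum_nonneg)
  qed
  \<comment> \<open>One factor \<open>\<kappa> t\<close> moves to the right of \<open>X\<close>, as it belongs to the centralizer.\<close>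
  have "E (\<kappa> t * (\<kappa> t * X)) = E (\<kappa> t * X * \<kappa> t)" for t
    using S_cent \<kappa>S[of t] by (auto simp: centralizer_def)
  then have "(\<Sum>t\<in>F. E (\<kappa> t * X * \<kappa> t)) = E (\<Sum>t\<in>F. \<kappa> t * \<kappa> t * X)"
    by (simp add: E.sum mult.assoc)
  also have "(\<Sum>t\<in>F. \<kappa> t * \<kappa> t * X) = X" by (simp add: one flip: sum_distrib_right)
  finally have EX: "E X = (\<Sum>t\<in>F. E (\<kappa> t * X * \<kappa> t))" by simp
  have "E X - E Y + e *\<^sub>R E 1 = (\<Sum>t\<in>F. E (\<kappa> t * (X - A t) * \<kappa> t)) + E Z"
    unfolding EX Z_def
    by (simp add: E.add E.diff E.sum E.scaleR algebra_simps sum_subtractf)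
  moreover have "pos (E (\<kappa> t * (X - A t) * \<kappa> t))" if "t \<in> F" for t
  proof (rule E.pos_pos)
    have "pos (X - A t)" unfolding A_def using vc(2) F(1) that by blast
    then show "pos (\<kappa> t * (X - A t) * \<kappa> t)"
      using pos_conj[OF _ star_H[OF \<kappa>H]] pos_star_mult by metis
  qed
  ultimately show "pos (E X - E Y + e *\<^sub>R E 1)"
    by (simp only:) (intro pos_add pos_sum E.pos_pos[OF Zpos])
qed

section \<open>Jensen inequality under a conditional expectation\<close>

theorem theorem4p6:
  fixes \<phi> :: "'a::cstar_algebra \<Rightarrow> 'b::cstar_algebra"
    and E :: "'b \<Rightarrow> 'b" and C :: "'b set"
    and f :: "real ^ 'n \<Rightarrow> real" and U :: "(real ^ 'n) set"
    and a :: "'n::finite \<Rightarrow> 'a"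
    and g :: "real \<Rightarrow> real" and I :: "real set"
  assumes "clinear_map \<phi>" and "positive_map_into UNIV \<phi>" and "\<phi> 1 = 1"
    and "cstar_subalgebra C" and "conditional_expectation C E"
    and "open U" and "convex U" and "convex_on U f"
    and "\<And>i. star (a i) = a i" and "\<And>i j. a i * a j = a j * a i"
    and "{x. \<forall>i. complex_of_real (x $ i) \<in> spectrum (a i)} \<subseteq> U"
    and "\<And>i. \<phi> (a i) \<in> centralizer E"
    and "\<And>i j. \<phi> (a i) * \<phi> (a j) = \<phi> (a j) * \<phi> (a i)"
    and "open I" and "is_interval I" and "convex_on I g" and "mono_on I g"
    and "f ` U \<subseteq> I"
  shows "le_in C (E (func_calc1 g (func_calc f (\<lambda>i. \<phi> (a i)))))
                 (E (func_calc1 g (\<phi> (func_calc f a))))"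
proof -
  interpret \<phi>: positive_map \<phi>
    by unfold_locales (use assms(1,2) in \<open>auto simp: positive_map_into_def positive_in_UNIV_iff\<close>)
  have Epos: "positive_map E"
  proof
    show "clinear_map E" using assms(5) by (simp add: conditional_expectation_def)
    show "pos (E x)" if "pos x" for x
      using assms(5) that pos_star_mult
      by (auto simp: conditional_expectation_def positive_map_into_def positive_in_UNIV_iff)
        (auto simp: positive_in_def pos_star_mult)
  qed
  have Ebl: "bounded_linear E" and EC: "\<And>x. E x \<in> C"
    using assms(5) by (auto simp: conditional_expectation_def)
  define b where "b = (\<lambda>i. \<phi> (a i))"
  interpret A: commuting_family a by unfold_locales (use assms(9,10) in auto)
  interpret B: commuting_family b
    by unfold_locales (use assms(9,13) \<phi>.selfadj in \<open>auto simp: b_def\<close>)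
  have KaU: "convex hull A.K \<subseteq> U"
  proof (rule hull_minimal)
    show "A.K \<subseteq> U"
    proof
      fix t assume "t \<in> A.K"
      then obtain \<gamma> where "A.character \<gamma>" "A.pt \<gamma> = t" by (rule A.K_pt)
      then have "\<forall>i. complex_of_real (t $ i) \<in> spectrum (a i)" using A.pt_spectrum by blast
      then show "t \<in> U" using assms(11) by blast
    qed
  qed (fact assms(7))
  \<comment> \<open>A point outside the convex hull would be separated from it by an affine function that is positive
    at \<open>a\<close> and hence at \<open>b\<close>, but negative at that point.\<close>
  have KbQ: "B.K \<subseteq> convex hull A.K"
  proof
    fix t assume "t \<in> B.K"
    then obtain \<gamma> where g: "B.character \<gamma>" "B.pt \<gamma> = t" by (rule B.K_pt)
    show "t \<in> convex hull A.K"
    proof (rule ccontr)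
      assume "t \<notin> convex hull A.K"
      then obtain v c where v: "v \<bullet> t < c" "\<forall>x\<in>convex hull A.K. c < v \<bullet> x"
        using separating_hyperplane_closed_point[OF convex_convex_hull
            compact_imp_closed[OF compact_convex_hull[OF A.compact_K]]] by blast
      have "pos (affine_at a v (- c))"
      proof (rule A.pos_of_chars[OF A.affine_at_H])
        fix \<delta> assume d: "A.character \<delta>"
        show "Re (\<delta> (affine_at a v (- c))) \<ge> 0"
          using v(2) hull_subset[of A.K convex] A.pt_K[OF d]
          by (simp add: A.char_affine_at[OF d] less_imp_le subset_iff)
      qed
      from \<phi>.pos_pos[OF this] have "pos (affine_at b v (- c))"
        by (simp only: \<phi>.affine_at[OF assms(3)] b_def)
      then have "Re (\<gamma> (affine_at b v (- c))) \<ge> 0" by (rule B.char_pos[OF g(1) B.affine_at_H])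
      then show False using v(1) g(2) by (simp add: B.char_affine_at[OF g(1)])
    qed
  qed
  have KAU: "A.K \<subseteq> U" and KBU: "B.K \<subseteq> U"
    using KaU KbQ hull_subset[of A.K convex] by auto
  have fU: "continuous_on U f" by (rule convex_on_continuous[OF assms(6,8)])
  have fA: "continuous_on A.K f" and fB: "continuous_on B.K f"
    using continuous_on_subset[OF fU] KAU KBU by auto
  have gI: "continuous_on I g" by (rule convex_on_continuous[OF assms(14,16)])
  have range: "\<exists>m M. (\<forall>x\<in>L. m \<le> f x \<and> f x \<le> M) \<and> {m..M} \<subseteq> I"
    if L: "compact L" "L \<noteq> {}" "L \<subseteq> U" "continuous_on L f" for L
  proof -
    obtain p where p: "p \<in> L" "\<forall>x\<in>L. f p \<le> f x" using continuous_attains_inf[OF L(1,2,4)] by blast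
    obtain q where q: "q \<in> L" "\<forall>x\<in>L. f x \<le> f q" using continuous_attains_sup[OF L(1,2,4)] by blast
    have "f p \<in> I" "f q \<in> I" using p(1) q(1) L(3) assms(18) by blast+
    then have "{f p..f q} \<subseteq> I" using assms(15) by (meson atLeastAtMost_iff is_interval_1 subsetI)
    then show ?thesis using p q by blast
  qed
  obtain m M where mM: "\<forall>x\<in>A.K. m \<le> f x \<and> f x \<le> M" "{m..M} \<subseteq> I"
    using range[OF A.compact_K A.K_nonempty KAU fA] by blast
  obtain m' M' where mM': "\<forall>x\<in>B.K. m' \<le> f x \<and> f x \<le> M'" "{m'..M'} \<subseteq> I"
    using range[OF B.compact_K B.K_nonempty KBU fB] by blast
  define T where "T = \<phi> (func_calc f a)"
  interpret T: bounded_selfadj T m M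
  proof
    have "pos (func_calc f a - m *\<^sub>R 1)" "pos (M *\<^sub>R 1 - func_calc f a)"
      using A.func_calc_bounds[OF fA, of m M] mM(1) by auto
    then have "pos (\<phi> (func_calc f a - m *\<^sub>R 1))" "pos (\<phi> (M *\<^sub>R 1 - func_calc f a))"
      by (auto intro: \<phi>.pos_pos)
    then show "pos (T - m *\<^sub>R 1)" "pos (M *\<^sub>R 1 - T)"
      by (simp_all add: T_def \<phi>.diff \<phi>.scaleR assms(3))
  qed
  have gm: "continuous_on {m..M} g" and gm': "continuous_on {m'..M'} g"
    using continuous_on_subset[OF gI] mM(2) mM'(2) by auto
  define X where "X = func_calc1 g T"
  define Y where "Y = func_calc1 g (func_calc f b)"
  have Y: "Y \<in> B.H" "\<And>\<gamma>. B.character \<gamma> \<Longrightarrow> \<gamma> Y = complex_of_real (g (f (B.pt \<gamma>)))"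
    unfolding Y_def using B.func_calc1_func_calc[OF fB _ gm'] mM'(1) by auto
  have "pos (E X - E Y)"
  proof (rule B.expectation_ge_of_affine_minorants[OF Epos Ebl _ _ Y])
    show "b i \<in> centralizer E" for i unfolding b_def by (rule assms(12))
    show "continuous_on B.K (\<lambda>x. g (f x))"
      by (rule continuous_on_compose2[OF gI fB]) (use KBU assms(18) in auto)
    fix t assume t: "t \<in> B.K"
    define s where "s = f t"
    have tU: "t \<in> U" and sI: "s \<in> I" using t KBU assms(18) by (auto simp: s_def)
    obtain v where v: "\<And>x. x \<in> U \<Longrightarrow> s + v \<bullet> (x - t) \<le> f x"
      using convex_subgradient[OF assms(6,8) tU] by (auto simp: s_def)
    obtain \<beta> where \<beta>: "\<And>u. u \<in> I \<Longrightarrow> g s + \<beta> * (u - s) \<le> g u"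
      using convex_subgradient[OF assms(14,16) sI] by auto
    have \<beta>0: "\<beta> \<ge> 0"
    proof -
      obtain e where e: "e > 0" "cball s e \<subseteq> I" using assms(14) sI open_contains_cball by blast
      have "s - e \<in> cball s e" using e(1) by (simp add: dist_real_def)
      then have u: "s - e \<in> I" using e(2) by blast
      then have "g (s - e) \<le> g s" using assms(17) sI e(1) by (auto intro: mono_onD)
      then have "\<beta> * e \<ge> 0" using \<beta>[OF u] by simp
      then show ?thesis using e(1) by (simp add: zero_le_mult_iff)
    qed
    have 1: "pos (X - (g s *\<^sub>R 1 + \<beta> *\<^sub>R (T - s *\<^sub>R 1)))"
      unfolding X_def by (rule T.tangent_func_calc1[OF gm]) (use \<beta> mM(2) in auto)
    have "pos (func_calc f a - affine_at a v (s - v \<bullet> t))"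
      by (rule A.affine_minorant_func_calc[OF fA])
        (use v KAU in \<open>force simp: inner_diff_right algebra_simps\<close>)
    then have "pos (\<phi> (func_calc f a - affine_at a v (s - v \<bullet> t)))" by (rule \<phi>.pos_pos)
    then have 2: "pos (T - affine_at b v (s - v \<bullet> t))"
      by (simp add: \<phi>.diff \<phi>.affine_at[OF assms(3)] T_def b_def)
    have "pos ((X - (g s *\<^sub>R 1 + \<beta> *\<^sub>R (T - s *\<^sub>R 1))) + \<beta> *\<^sub>R (T - affine_at b v (s - v \<bullet> t)))"
      by (intro pos_add 1 pos_scaleR 2 \<beta>0)
    also have "(X - (g s *\<^sub>R 1 + \<beta> *\<^sub>R (T - s *\<^sub>R 1))) + \<beta> *\<^sub>R (T - affine_at b v (s - v \<bullet> t))
      = X - affine_at b (\<beta> *\<^sub>R v) (g s - \<beta> * (v \<bullet> t))"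
      by (simp add: affine_at_def algebra_simps scaleR_sum_right)
    finally have "pos (X - affine_at b (\<beta> *\<^sub>R v) (g s - \<beta> * (v \<bullet> t)))" .
    moreover have "(\<beta> *\<^sub>R v) \<bullet> t + (g s - \<beta> * (v \<bullet> t)) = g (f t)" by (simp add: s_def)
    ultimately show "\<exists>v c. v \<bullet> t + c = g (f t) \<and> pos (X - affine_at b v c)" by blast
  qed
  moreover have "E X - E Y \<in> C" using cstar_subalgebraD(9)[OF assms(4)] EC by blast
  ultimately have "positive_in C (E X - E Y)" by (intro positive_in_subalgebra assms(4))
  then show ?thesis
    unfolding le_in_def X_def[symmetric] Y_def[symmetric] T_def[symmetric] b_def[symmetric]
    using EC by blast
qed

end
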